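(* Let $G$ be a topological Abelian group, let $E$ be a Banach space over $\mathbb{C}$, and suppose that there is a dense subgroup $H$ of $G$ such that $r_0(H)<\infty$. Then for a continuous function $f\colon G\to E$ the following properties are equivalent: (i) $f$ is a polynomial; (ii) $f$ is a w-polynomial; (iii) $f$ is a generalized polynomial; (iv) $f$ is a local polynomial.
   Context: For an Abelian group $H$, $r_0(H)$ denotes its torsion free rank, that is, the cardinality of a maximal independent system of elements of infinite order. For a function $f$ on $G$ (or on a subsemigroup) with values in a complex vector space, put $T_g f(x)=f(x+g)$ and $\Delta_g f(x)=f(x+g)-f(x)$; $L_f$ denotes the complex linear span of all translates $T_g f$. $E^*$ is the space of continuous linear functionals on $E$. A continuous function $f\colon G\to E$ is a generalized polynomial if there is an $n\ge 0$ such that $\Delta_{h_1}\cdots\Delta_{h_{n+1}}f=0$ for every $h_1,\ldots,h_{n+1}\in G$. It is a polynomial if it is a generalized polynomial and $\dim L_f<\infty$. A complex valued function $f\colon G\to\mathbb{C}$ is a (complex valued) polynomial if there are continuous additive functions $a_1,\ldots,a_n\colon G\to\mathbb{C}$ and $P\in\mathbb{C}[x_1,\ldots,x_n]$ such that $f=P(a_1,\ldots,a_n)$. A continuous function $f\colon G\to E$ is a w-polynomial if $u\circ f$ is a complex valued polynomial for every $u\in E^*$. A continuous function $f\colon G\to E$ is a local polynomial if the restriction of $f$ to any finitely generated subsemigroup of $G$ is a polynomial (on that subsemigroup; the definitions of generalized polynomial and polynomial apply verbatim to topological Abelian semigroups). *)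

theory Defs
  imports
    "HOL-Analysis.Analysis"
    "HOL-Library.Function_Algebras"
    "HOL-Library.Poly_Mapping"
    "HOL-Library.Extended_Nat"
begin

section \<open>Complex Banach spaces\<close>

text \<open>
  The libraries only provide real Banach spaces. A complex one is a real one with a compatible
  complex scalar multiplication for which the norm is homogeneous.
\<close>

class complex_banach = banach +
  fixes scaleC :: "complex \<Rightarrow> 'a \<Rightarrow> 'a"  (infixr \<open>*\<^sub>C\<close> 75)
  assumes scaleC_add_right: "c *\<^sub>C (x + y) = c *\<^sub>C x + c *\<^sub>C y"
    and scaleC_add_left: "(c + d) *\<^sub>C x = c *\<^sub>C x + d *\<^sub>C x"
    and scaleC_scaleC: "c *\<^sub>C d *\<^sub>C x = (c * d) *\<^sub>C x"
    and scaleC_of_real: "complex_of_real r *\<^sub>C x = r *\<^sub>R x"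
    and norm_scaleC: "norm (c *\<^sub>C x) = cmod c * norm x"

instantiation complex :: complex_banach
begin

definition scaleC_complex :: "complex \<Rightarrow> complex \<Rightarrow> complex"
  where "scaleC_complex c z = c * z"

instance
  by standard (simp_all add: scaleC_complex_def algebra_simps norm_mult scaleR_conv_of_real)

end

global_interpretation cspace: vector_space "scaleC :: complex \<Rightarrow> 'e \<Rightarrow> 'e::complex_banach"
proof
  show "1 *\<^sub>C x = x" for x :: 'e
    using scaleC_of_real[of 1 x] by simp
qed (rule scaleC_add_right scaleC_add_left scaleC_scaleC)+

definition dual_space :: "('e::complex_banach \<Rightarrow> complex) set"
  where "dual_space = {u. Vector_Spaces.linear scaleC (*) u \<and> continuous_on UNIV u}"

definition fun_scaleC :: "complex \<Rightarrow> ('a \<Rightarrow> 'e) \<Rightarrow> 'a \<Rightarrow> 'e::complex_banach"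
  where "fun_scaleC c f = (\<lambda>x. c *\<^sub>C f x)"

global_interpretation cfun: vector_space "fun_scaleC :: complex \<Rightarrow> ('a \<Rightarrow> 'e) \<Rightarrow> 'a \<Rightarrow> 'e::complex_banach"
  by standard
    (auto simp: fun_scaleC_def fun_eq_iff scaleC_add_right scaleC_add_left scaleC_scaleC)

text \<open>
  Finite-dimensionality is not expressed through \<^term>\<open>cfun.dim\<close>, which is a junk value
  (namely 0) on infinite-dimensional spaces.
\<close>

definition finite_dim_subspace :: "('a \<Rightarrow> 'e::complex_banach) set \<Rightarrow> bool"
  where "finite_dim_subspace V \<longleftrightarrow> (\<exists>B. finite B \<and> V = cfun.span B)"


section \<open>Torsion free rank\<close>

definition add_subgroup :: "'a::ab_group_add set \<Rightarrow> bool"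
  where "add_subgroup H \<longleftrightarrow> 0 \<in> H \<and> (\<forall>x\<in>H. \<forall>y\<in>H. x + y \<in> H) \<and> (\<forall>x\<in>H. - x \<in> H)"

definition nat_mult :: "nat \<Rightarrow> 'a::ab_group_add \<Rightarrow> 'a"
  where "nat_mult n x = (\<Sum>i<n. x)"

definition int_mult :: "int \<Rightarrow> 'a::ab_group_add \<Rightarrow> 'a"
  where "int_mult k x = nat_mult (nat k) x - nat_mult (nat (- k)) x"

lemma nat_mult_add_left: "nat_mult (m + n) x = nat_mult m x + nat_mult n x"
  by (induction n) (simp_all add: nat_mult_def add.assoc)

lemma nat_mult_add_right: "nat_mult n (x + y) = nat_mult n x + nat_mult n y"
  by (simp add: nat_mult_def sum.distrib)

lemma nat_mult_diff_right: "nat_mult n (x - y) = nat_mult n x - nat_mult n y"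
  by (simp add: nat_mult_def sum_subtractf)

lemma nat_mult_mult: "nat_mult m (nat_mult n x) = nat_mult (m * n) x"
proof (induction m)
  case (Suc m)
  have "nat_mult (Suc m) (nat_mult n x) = nat_mult m (nat_mult n x) + nat_mult n x"
    by (simp add: nat_mult_def)
  then show ?case
    by (simp add: Suc nat_mult_add_left add.commute)
qed (simp add: nat_mult_def)

lemma int_mult_diff: "int_mult (int m - int n) x = nat_mult m x - nat_mult n x"
proof (cases "n \<le> m")
  case True
  then obtain k where "m = n + k" using le_Suc_ex by blast
  then show ?thesis by (simp add: int_mult_def nat_mult_add_left nat_mult_def[of 0])
next
  case False
  then obtain k where "n = m + k" by (metis le_Suc_ex nat_le_linear)
  then show ?thesis by (simp add: int_mult_def nat_mult_add_left nat_mult_def[of 0])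
qed

global_interpretation zmod: module "int_mult :: int \<Rightarrow> 'a \<Rightarrow> 'a::ab_group_add"
proof
  fix k l :: int and x y :: 'a
  obtain a b where k: "k = int a - int b" by (cases k rule: int_diff_cases)
  obtain c d where l: "l = int c - int d" by (cases l rule: int_diff_cases)
  show "int_mult k (x + y) = int_mult k x + int_mult k y"
    by (simp add: int_mult_def nat_mult_add_right)
  have "k + l = int (a + c) - int (b + d)" by (simp add: k l)
  then show "int_mult (k + l) x = int_mult k x + int_mult l x"
    by (simp only: k l int_mult_diff) (simp add: nat_mult_add_left)
  have "k * l = int (a * c + b * d) - int (a * d + b * c)" by (simp add: k l algebra_simps)
  then show "int_mult k (int_mult l x) = int_mult (k * l) x"
    by (simp only: k l int_mult_diff nat_mult_diff_right nat_mult_mult)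
      (simp add: nat_mult_add_left)
  show "int_mult 1 x = x"
    by (simp add: int_mult_def nat_mult_def)
qed

text \<open>Independence is linear independence over the integers.\<close>

definition infinite_order :: "'a::ab_group_add \<Rightarrow> bool"
  where "infinite_order x \<longleftrightarrow> (\<forall>n>0. nat_mult n x \<noteq> 0)"

definition indep_system :: "'a::ab_group_add set \<Rightarrow> 'a set \<Rightarrow> bool"
  where "indep_system H B \<longleftrightarrow>
    B \<subseteq> H \<and> (\<forall>x\<in>B. infinite_order x) \<and> zmod.independent B"

definition maximal_indep_system :: "'a::ab_group_add set \<Rightarrow> 'a set \<Rightarrow> bool"
  where "maximal_indep_system H B \<longleftrightarrow>
    indep_system H B \<and> (\<forall>C. indep_system H C \<and> B \<subseteq> C \<longrightarrow> C = B)"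

lemma ex_maximal_indep_system: "\<exists>B. maximal_indep_system H B"
proof -
  have "\<exists>M\<in>{B. indep_system H B}. \<forall>X\<in>{B. indep_system H B}. M \<subseteq> X \<longrightarrow> X = M"
  proof (rule subset_Zorn')
    fix C assume C: "subset.chain {B. indep_system H B} C"
    have "zmod.independent (\<Union>C)"
      by (rule zmod.independent_Union_directed)
        (use C in \<open>auto simp: subset_chain_def indep_system_def\<close>)
    then show "\<Union>C \<in> {B. indep_system H B}"
      using C by (auto simp: subset_chain_def indep_system_def)
  qed
  then show ?thesis
    unfolding maximal_indep_system_def by blast
qed

text \<open>
  All maximal independent systems have the same cardinality, so the choice is immaterial.
  Infinite ranks are not distinguished from one another.
\<close>

definition torsion_free_rank :: "'a::ab_group_add set \<Rightarrow> enat"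
  where "torsion_free_rank H =
    (let B = SOME B. maximal_indep_system H B in if finite B then enat (card B) else \<infinity>)"


section \<open>Polynomials\<close>

text \<open>
  The notions below are relative to a subsemigroup \<open>S\<close> of the group. The restriction of \<open>f\<close>
  to \<open>S\<close> is represented by the values of \<open>f\<close> on \<open>S\<close>; functions on \<open>S\<close> are identified with
  functions on the whole group vanishing outside \<open>S\<close>.
\<close>

definition difference :: "'a::plus \<Rightarrow> ('a \<Rightarrow> 'e::minus) \<Rightarrow> 'a \<Rightarrow> 'e"
  where "difference h f = (\<lambda>x. f (x + h) - f x)"

definition generalized_polynomial_on ::
    "'a::topological_ab_group_add set \<Rightarrow> ('a \<Rightarrow> 'e::complex_banach) \<Rightarrow> bool"
  where "generalized_polynomial_on S f \<longleftrightarrow> continuous_on S f \<and>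
    (\<exists>n. \<forall>hs. length hs = n + 1 \<and> set hs \<subseteq> S \<longrightarrow> (\<forall>x\<in>S. foldr difference hs f x = 0))"

definition translates_on ::
    "'a::topological_ab_group_add set \<Rightarrow> ('a \<Rightarrow> 'e::complex_banach) \<Rightarrow> ('a \<Rightarrow> 'e) set"
  where "translates_on S f = (\<lambda>g x. if x \<in> S then f (x + g) else 0) ` S"

definition polynomial_on ::
    "'a::topological_ab_group_add set \<Rightarrow> ('a \<Rightarrow> 'e::complex_banach) \<Rightarrow> bool"
  where "polynomial_on S f \<longleftrightarrow>
    generalized_polynomial_on S f \<and> finite_dim_subspace (cfun.span (translates_on S f))"

abbreviation generalized_polynomial ::
    "('a::topological_ab_group_add \<Rightarrow> 'e::complex_banach) \<Rightarrow> bool"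
  where "generalized_polynomial f \<equiv> generalized_polynomial_on UNIV f"

abbreviation polynomial ::
    "('a::topological_ab_group_add \<Rightarrow> 'e::complex_banach) \<Rightarrow> bool"
  where "polynomial f \<equiv> polynomial_on UNIV f"

text \<open>
  Elements of \<^typ>\<open>(nat \<Rightarrow>\<^sub>0 nat) \<Rightarrow>\<^sub>0 complex\<close> are the complex polynomials in the
  indeterminates with indices in \<^typ>\<open>nat\<close>: finitely supported families of coefficients, indexed
  by finitely supported families of exponents.
\<close>

definition mpoly_vars :: "((nat \<Rightarrow>\<^sub>0 nat) \<Rightarrow>\<^sub>0 complex) \<Rightarrow> nat set"
  where "mpoly_vars P = (\<Union>m\<in>Poly_Mapping.keys P. Poly_Mapping.keys m)"

definition mpoly_eval :: "((nat \<Rightarrow>\<^sub>0 nat) \<Rightarrow>\<^sub>0 complex) \<Rightarrow> (nat \<Rightarrow> complex) \<Rightarrow> complex"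
  where "mpoly_eval P v =
    (\<Sum>m\<in>Poly_Mapping.keys P. Poly_Mapping.lookup P m *
      (\<Prod>i\<in>Poly_Mapping.keys m. v i ^ Poly_Mapping.lookup m i))"

definition complex_polynomial :: "('a::topological_ab_group_add \<Rightarrow> complex) \<Rightarrow> bool"
  where "complex_polynomial f \<longleftrightarrow>
    (\<exists>n (a :: nat \<Rightarrow> 'a \<Rightarrow> complex) P.
      (\<forall>i<n. Modules.additive (a i) \<and> continuous_on UNIV (a i)) \<and>
      mpoly_vars P \<subseteq> {..<n} \<and>
      f = (\<lambda>x. mpoly_eval P (\<lambda>i. a i x)))"

definition w_polynomial ::
    "('a::topological_ab_group_add \<Rightarrow> 'e::complex_banach) \<Rightarrow> bool"
  where "w_polynomial f \<longleftrightarrow>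
    continuous_on UNIV f \<and> (\<forall>u\<in>dual_space. complex_polynomial (u \<circ> f))"

inductive_set subsemigroup_gen :: "'a::plus set \<Rightarrow> 'a set" for X :: "'a set"
  where
    base: "x \<in> X \<Longrightarrow> x \<in> subsemigroup_gen X"
  | add: "x \<in> subsemigroup_gen X \<Longrightarrow> y \<in> subsemigroup_gen X \<Longrightarrow> x + y \<in> subsemigroup_gen X"

definition local_polynomial ::
    "('a::topological_ab_group_add \<Rightarrow> 'e::complex_banach) \<Rightarrow> bool"
  where "local_polynomial f \<longleftrightarrow> continuous_on UNIV f \<and>
    (\<forall>X. finite X \<and> X \<noteq> {} \<longrightarrow> polynomial_on (subsemigroup_gen X) f)"

end

theory Submission
  imports Defs
begin

text \<open>
  For a continuous function on a group with a dense subgroup \<open>H\<close> of finite rank, all four properties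
  amount to one: some number bounds the degree of \<open>f\<close>, that is, all differences of \<open>f\<close> of a
  certain order vanish.
  
  Finite rank provides a finitely generated subgroup \<open>F\<close> of \<open>H\<close> such that every element of \<open>H\<close> has a
  positive multiple in \<open>F\<close>. The principle behind the proof is
  \<open>degree_less_on_torsion_extension\<close>: a function of finite degree on \<open>H\<close> has no larger degree on
  \<open>H\<close> than on \<open>F\<close>, and for a continuous function the bound extends from \<open>H\<close> to the whole group
  (\<open>degree_less_on_dense\<close>). In particular a continuous function of finite degree that vanishes on
  \<open>F\<close> is \<open>0\<close>.
  
  A local polynomial has some degree on \<open>F\<close>, and the principle makes this degree a bound on the
  whole group. Conversely, on a finitely generated semigroup the translates of a function of bounded
  degree lie in the span of its finitely many iterated differences along the generators
  (\<open>translates_in_finite_span\<close>), so it is a local polynomial. The same argument places the translates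
  by elements of \<open>F\<close> in a finite-dimensional space. That space contains all other translates as well:
  a functional separating one of them from it would give a continuous scalar function of finite
  degree that vanishes on \<open>F\<close> without being \<open>0\<close>. Thus a function of bounded degree is a polynomial.
  
  If \<open>f\<close> is a w-polynomial, each \<open>u \<circ> f\<close> has a degree, and the Baire category theorem in the dual
  space makes these degrees uniformly bounded (\<open>degree_less_of_functionals\<close>). Conversely, let \<open>f\<close>
  have bounded degree and let \<open>p = u \<circ> f\<close>. Continuous additive functions are determined by their
  values on generators of \<open>F\<close>, so there are finitely many points \<open>b\<close> and continuous additive
  \<open>\<alpha> b\<close> with \<open>a x = (\<Sum>b. a b * \<alpha> b x)\<close> for every continuous additive \<open>a\<close>. In these
  coordinates Euler's identity holds: if \<open>p\<close> has degree at most \<open>d\<close>, then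
  \<open>(\<Sum>b. \<alpha> b x * difference b p x) - d * p x\<close> has smaller degree (\<open>degree_less_euler\<close>). Solving
  for \<open>p\<close> shows by induction on the degree that \<open>p\<close> is a polynomial in the \<open>\<alpha> b\<close>.
\<close>

section \<open>Functions of bounded degree\<close>

lemma difference_commute:
  fixes f :: "'a::ab_semigroup_add \<Rightarrow> 'e::ab_group_add"
  shows "difference h (difference k f) = difference k (difference h f)"
  by (simp add: difference_def fun_eq_iff ac_simps)

lemma foldr_difference_commute:
  fixes f :: "'a::ab_semigroup_add \<Rightarrow> 'e::ab_group_add"
  shows "foldr difference hs (difference h f) = difference h (foldr difference hs f)"
  by (induction hs) (simp_all add: difference_commute[of _ h])

lemma difference_additive_compose:
  assumes "Modules.additive u"
  shows "difference h (\<lambda>x. u (f x)) = (\<lambda>x. u (difference h f x))"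
  by (simp add: difference_def additive.diff[OF assms])

lemma foldr_difference_additive_compose:
  assumes "Modules.additive u"
  shows "foldr difference hs (\<lambda>x. u (f x)) = (\<lambda>x. u (foldr difference hs f x))"
  by (induction hs) (simp_all add: difference_additive_compose[OF assms])

text \<open>
  Unlike a generalized polynomial, this notion carries the bound on the degree and asks for no
  continuity. Allowing \<open>n = 0\<close>, which says that \<open>f\<close> vanishes on \<open>S\<close>, makes uniqueness statements
  the case of degree \<open>0\<close> of statements about degrees.
\<close>

definition degree_less_on :: "'a::ab_semigroup_add set \<Rightarrow> nat \<Rightarrow> ('a \<Rightarrow> 'e::ab_group_add) \<Rightarrow> bool"
  where "degree_less_on S n f \<longleftrightarrow>
    (\<forall>hs. length hs = n \<and> set hs \<subseteq> S \<longrightarrow> (\<forall>x\<in>S. foldr difference hs f x = 0))"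

lemma degree_less_onD:
  "degree_less_on S n f \<Longrightarrow> length hs = n \<Longrightarrow> set hs \<subseteq> S \<Longrightarrow> x \<in> S \<Longrightarrow> foldr difference hs f x = 0"
  by (simp add: degree_less_on_def)

lemma degree_less_on_0: "degree_less_on S 0 f \<longleftrightarrow> (\<forall>x\<in>S. f x = 0)"
  by (simp add: degree_less_on_def)

text \<open>
  Differences commute with each other, so a step may be taken off either end of the list of steps.
  This is what makes induction on the degree possible.
\<close>

lemma degree_less_on_Suc:
  "degree_less_on S (Suc n) f \<longleftrightarrow> (\<forall>h\<in>S. degree_less_on S n (difference h f))"
proof
  assume L: "degree_less_on S (Suc n) f"
  show "\<forall>h\<in>S. degree_less_on S n (difference h f)"
    unfolding degree_less_on_def
  proof (intro ballI allI impI, elim conjE)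
    fix h hs x assume "h \<in> S" "x \<in> S" "length hs = n" "set hs \<subseteq> S"
    then show "foldr difference hs (difference h f) x = 0"
      using degree_less_onD[OF L, of "hs @ [h]" x] by simp
  qed
next
  assume R: "\<forall>h\<in>S. degree_less_on S n (difference h f)"
  show "degree_less_on S (Suc n) f"
    unfolding degree_less_on_def
  proof (intro ballI allI impI, elim conjE)
    fix hs x assume *: "x \<in> S" "length hs = Suc n" "set hs \<subseteq> S"
    then obtain ks k where "hs = ks @ [k]" by (metis length_Suc_conv_rev)
    then show "foldr difference hs f x = 0"
      using * R degree_less_onD[of S n "difference k f" ks x] by simp
  qed
qed

lemma degree_less_on_difference:
  "degree_less_on S (Suc n) f \<Longrightarrow> h \<in> S \<Longrightarrow> degree_less_on S n (difference h f)"
  using degree_less_on_Suc by blast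

lemma degree_less_on_SucI:
  "(\<And>h. h \<in> S \<Longrightarrow> degree_less_on S n (difference h f)) \<Longrightarrow> degree_less_on S (Suc n) f"
  using degree_less_on_Suc by blast

lemma degree_less_on_subset:
  "degree_less_on S n f \<Longrightarrow> T \<subseteq> S \<Longrightarrow> degree_less_on T n f"
  unfolding degree_less_on_def by blast

lemma degree_less_on_Suc_mono:
  assumes add: "\<And>x y. x \<in> S \<Longrightarrow> y \<in> S \<Longrightarrow> x + y \<in> S" and "degree_less_on S n f"
  shows "degree_less_on S (Suc n) f"
  unfolding degree_less_on_def
proof (intro ballI allI impI, elim conjE)
  fix hs x assume *: "x \<in> S" "length hs = Suc n" "set hs \<subseteq> S"
  then obtain k ks where "hs = k # ks" by (metis length_Suc_conv)
  then show "foldr difference hs f x = 0"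
    using * degree_less_onD[OF assms(2), of ks] add[of x k]
    by (simp add: difference_def)
qed

lemma degree_less_on_mono:
  assumes "\<And>x y. x \<in> S \<Longrightarrow> y \<in> S \<Longrightarrow> x + y \<in> S"
    and "degree_less_on S m f" and "m \<le> n"
  shows "degree_less_on S n f"
  using assms(3,2)
  by (induction rule: dec_induct) (auto intro: degree_less_on_Suc_mono assms(1))

lemma degree_less_mono: "degree_less_on UNIV m f \<Longrightarrow> m \<le> n \<Longrightarrow> degree_less_on UNIV n f"
  using degree_less_on_mono by blast

lemma generalized_polynomial_on_iff:
  assumes "\<And>x y. x \<in> S \<Longrightarrow> y \<in> S \<Longrightarrow> x + y \<in> S"
  shows "generalized_polynomial_on S f \<longleftrightarrow> continuous_on S f \<and> (\<exists>n. degree_less_on S n f)"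
  unfolding generalized_polynomial_on_def degree_less_on_def[symmetric]
  using degree_less_on_Suc_mono[OF assms] by auto

lemma degree_less_zero: "degree_less_on UNIV n (\<lambda>x. 0)"
  by (induction n) (simp_all add: degree_less_on_0 degree_less_on_Suc difference_def)

lemma difference_add: "difference h (\<lambda>x. f x + g x) = (\<lambda>x. difference h f x + difference h g x)"
  for f :: "_ \<Rightarrow> 'e::ab_group_add"
  by (simp add: difference_def fun_eq_iff)

lemma degree_less_on_add:
  "degree_less_on S n f \<Longrightarrow> degree_less_on S n g \<Longrightarrow> degree_less_on S n (\<lambda>x. f x + g x)"
  by (induction n arbitrary: f g) (simp_all add: degree_less_on_0 degree_less_on_Suc difference_add)

lemma degree_less_on_additive_compose:
  "Modules.additive u \<Longrightarrow> degree_less_on S n f \<Longrightarrow> degree_less_on S n (\<lambda>x. u (f x))"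
  by (simp add: degree_less_on_def foldr_difference_additive_compose additive.zero)

lemma degree_less_on_sum:
  "(\<And>i. i \<in> I \<Longrightarrow> degree_less_on UNIV n (f i)) \<Longrightarrow> degree_less_on UNIV n (\<lambda>x. \<Sum>i\<in>I. f i x)"
  by (induction I rule: infinite_finite_induct)
     (simp_all add: degree_less_zero degree_less_on_add)

lemma difference_mult:
  fixes f g :: "'a::ab_semigroup_add \<Rightarrow> 'r::comm_ring"
  shows "difference h (\<lambda>x. f x * g x) = (\<lambda>x. difference h f x * g x + f x * difference h g x
           + difference h f x * difference h g x)"
  by (simp add: difference_def fun_eq_iff algebra_simps)

lemma degree_less_mult:
  fixes f g :: "'a::ab_semigroup_add \<Rightarrow> 'r::comm_ring"
  shows "degree_less_on UNIV m f \<Longrightarrow> degree_less_on UNIV n g \<Longrightarrow>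
    degree_less_on UNIV (m + n) (\<lambda>x. f x * g x)"
proof (induction "m + n" arbitrary: m n f g)
  case 0
  then show ?case by (simp add: degree_less_on_0)
next
  case (Suc k)
  show ?case
  proof (cases "m = 0 \<or> n = 0")
    case True
    then have "(\<lambda>x. f x * g x) = (\<lambda>x. 0)"
      using Suc.prems by (auto simp: degree_less_on_0)
    then show ?thesis using degree_less_zero by metis
  next
    case False
    then obtain m' n' where mn: "m = Suc m'" "n = Suc n'" by (metis not0_implies_Suc)
    have "degree_less_on UNIV k (difference h (\<lambda>x. f x * g x))" for h
    proof -
      have f: "degree_less_on UNIV m' (difference h f)" and g: "degree_less_on UNIV n' (difference h g)"
        using Suc.prems by (simp_all add: mn degree_less_on_Suc)
      have f': "degree_less_on UNIV m (difference h f)"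
        using f by (rule degree_less_mono) (simp add: mn)
      have "degree_less_on UNIV k (\<lambda>x. difference h f x * g x)"
        using Suc.hyps(1)[of m' n "difference h f" g] Suc.hyps(2) Suc.prems f by (simp add: mn)
      moreover have "degree_less_on UNIV k (\<lambda>x. f x * difference h g x)"
        using Suc.hyps(1)[of m n' f "difference h g"] Suc.hyps(2) Suc.prems g by (simp add: mn)
      moreover have "degree_less_on UNIV k (\<lambda>x. difference h f x * difference h g x)"
        using Suc.hyps(1)[of m n' "difference h f" "difference h g"] Suc.hyps(2) f' g by (simp add: mn)
      ultimately show ?thesis
        unfolding difference_mult by (intro degree_less_on_add)
    qed
    then show ?thesis
      by (simp add: Suc.hyps(2)[symmetric] degree_less_on_Suc)
  qed
qed

lemma degree_less_const: "degree_less_on UNIV 1 (\<lambda>x. c)"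
  by (simp add: degree_less_on_Suc degree_less_on_0 difference_def)

lemma degree_less_additive: "Modules.additive a \<Longrightarrow> degree_less_on UNIV 2 a"
  by (simp add: numeral_2_eq_2 degree_less_on_Suc degree_less_on_0 difference_def additive.add)

section \<open>Degrees pass to torsion extensions and to closures\<close>

lemma nat_mult_0 [simp]: "nat_mult 0 x = 0"
  and nat_mult_Suc: "nat_mult (Suc n) x = nat_mult n x + x"
  by (simp_all add: nat_mult_def)

lemma subgroup_nat_mult: "add_subgroup K \<Longrightarrow> x \<in> K \<Longrightarrow> nat_mult n x \<in> K"
  by (induction n) (auto simp: nat_mult_Suc add_subgroup_def)

text \<open>
  On \<open>K\<close>, a \<open>d\<close>-fold difference of a function of degree at most \<open>d\<close> is constant, and it is
  additive in each of its \<open>d\<close> steps. Multiplying a step by \<open>m > 0\<close> multiplies this constant by \<open>m\<close>.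
  Every step has a positive multiple in \<open>F\<close>, and once all steps lie in \<open>F\<close> the constant may be
  computed at \<open>0 \<in> F\<close>, where it vanishes. The steps are therefore moved into \<open>F\<close> one by one.
\<close>

lemma degree_less_on_drop_step:
  fixes f :: "'a::ab_group_add \<Rightarrow> 'e::real_vector"
  assumes K: "add_subgroup K" and F: "0 \<in> F" "F \<subseteq> K"
    and tor: "\<And>x. x \<in> K \<Longrightarrow> \<exists>m>0. nat_mult m x \<in> F"
    and dK: "degree_less_on K (Suc d) f" and dF: "degree_less_on F d f"
  shows "degree_less_on K d f"
proof -
  have K0: "0 \<in> K" and Kadd: "\<And>x y. x \<in> K \<Longrightarrow> y \<in> K \<Longrightarrow> x + y \<in> K"
    using K by (auto simp: add_subgroup_def)
  \<comment> \<open>\<open>as\<close> are the steps still to be moved into \<open>F\<close>, \<open>bs\<close> those already there.\<close>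
  have "\<forall>x\<in>K. foldr difference (as @ bs) f x = 0"
    if "set as \<subseteq> K" "set bs \<subseteq> F" "length as + length bs = d" for as bs
    using that
  proof (induction as arbitrary: bs)
    case Nil
    show ?case
    proof
      fix x assume x: "x \<in> K"
      have "foldr difference (x # bs) f 0 = 0"
        using Nil F x K0 by (intro degree_less_onD[OF dK]) auto
      moreover have "foldr difference bs f 0 = 0"
        using Nil F by (intro degree_less_onD[OF dF]) auto
      ultimately show "foldr difference ([] @ bs) f x = 0"
        by (simp add: difference_def)
    qed
  next
    case (Cons a as)
    define q where "q = foldr difference (as @ bs) f"
    have q2: "difference k (difference a q) x = 0" if "k \<in> K" "x \<in> K" for k x
      using degree_less_onD[OF dK, of "k # a # as @ bs" x] that Cons.prems F
      by (auto simp: q_def)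
    have a: "a \<in> K" using Cons.prems by simp
    show ?case
    proof
      fix x assume x: "x \<in> K"
      define c where "c = difference a q x"
      have const: "difference a q (x + k) = c" if "k \<in> K" for k
        using q2[OF that x] by (simp add: c_def difference_def)
      have mult: "q (x + nat_mult m a) - q x = real m *\<^sub>R c" for m
      proof (induction m)
        case (Suc m)
        have "q (x + nat_mult (Suc m) a) - q (x + nat_mult m a) = c"
          using const[of "nat_mult m a"] subgroup_nat_mult[OF K a]
          by (simp add: nat_mult_Suc difference_def add.assoc)
        then show ?case using Suc by (simp add: algebra_simps)
      qed simp
      obtain m where m: "m > 0" "nat_mult m a \<in> F" using tor[OF a] by blast
      have "foldr difference (as @ nat_mult m a # bs) f x = 0"
        using Cons.IH[of "nat_mult m a # bs"] Cons.prems m x by auto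
      then have "difference (nat_mult m a) q x = 0"
        by (simp add: q_def foldr_difference_commute)
      then have "real m *\<^sub>R c = 0" using mult[of m] by (simp add: difference_def)
      then show "foldr difference ((a # as) @ bs) f x = 0"
        using m by (simp add: c_def q_def)
    qed
  qed
  from this[of _ "[]"] show ?thesis
    by (auto simp: degree_less_on_def)
qed

text \<open>
  The finite degree \<open>N\<close> is lowered one by one down to \<open>n\<close>. For \<open>n = 0\<close> the result is a uniqueness
  theorem: a function of finite degree on \<open>K\<close> vanishes there as soon as it vanishes on \<open>F\<close>.
\<close>

lemma degree_less_on_torsion_extension:
  fixes f :: "'a::ab_group_add \<Rightarrow> 'e::real_vector"
  assumes K: "add_subgroup K" and F: "add_subgroup F" "F \<subseteq> K"
    and tor: "\<And>x. x \<in> K \<Longrightarrow> \<exists>m>0. nat_mult m x \<in> F"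
    and dK: "degree_less_on K N f" and dF: "degree_less_on F n f"
  shows "degree_less_on K n f"
proof (cases "N \<le> n")
  case True
  then show ?thesis using degree_less_on_mono[OF _ dK] K by (auto simp: add_subgroup_def)
next
  case False
  then have "n \<le> N" by simp
  then show ?thesis
  proof (induction rule: inc_induct)
    case (step d)
    have "degree_less_on F d f"
      using degree_less_on_mono[OF _ dF] F \<open>n \<le> d\<close> by (auto simp: add_subgroup_def)
    then show ?case
      using degree_less_on_drop_step[OF K _ F(2) tor step.IH] F by (auto simp: add_subgroup_def)
  qed (rule dK)
qed

lemma continuous_on_difference:
  fixes f :: "'a::topological_ab_group_add \<Rightarrow> 'e::topological_ab_group_add"
  assumes "continuous_on UNIV f"
  shows "continuous_on UNIV (difference h f)"
  unfolding difference_def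
  by (intro continuous_intros continuous_on_compose2[OF assms]) auto

lemma continuous_on_foldr_difference:
  fixes f :: "'a::topological_ab_group_add \<Rightarrow> 'e::topological_ab_group_add"
  assumes "continuous_on UNIV f"
  shows "continuous_on UNIV (foldr difference hs f)"
  by (induction hs) (simp_all add: assms continuous_on_difference)

lemma zero_on_dense:
  fixes g :: "'a::topological_space \<Rightarrow> 'e::real_normed_vector"
  assumes "continuous_on UNIV g" "closure H = UNIV" "\<And>x. x \<in> H \<Longrightarrow> g x = 0"
  shows "g x = 0"
proof -
  have "closed {x. g x = 0}"
    using closed_Collect_eq[OF assms(1) continuous_on_const] by simp
  then have "closure H \<subseteq> {x. g x = 0}"
    using assms(3) by (intro closure_minimal) auto
  then show ?thesis using assms(2) by auto
qed

text \<open>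
  For fixed \<open>x\<close> an iterated difference depends continuously on each of its steps, so the steps can
  be released from \<open>H\<close> one at a time.
\<close>

lemma degree_less_on_dense:
  fixes f :: "'a::topological_ab_group_add \<Rightarrow> 'e::real_normed_vector"
  assumes H: "closure H = UNIV" and "continuous_on UNIV f" "degree_less_on H n f"
  shows "degree_less_on UNIV n f"
  using assms(2,3)
proof (induction n arbitrary: f)
  case 0
  then show ?case using zero_on_dense[OF _ H] by (auto simp: degree_less_on_0)
next
  case (Suc n)
  have IH: "degree_less_on UNIV n (difference h f)" if "h \<in> H" for h
    using Suc that by (auto simp: degree_less_on_Suc intro: continuous_on_difference)
  have "foldr difference hs (difference h f) x = 0" if "length hs = n" for hs h x
  proof (rule zero_on_dense[OF _ H, of "\<lambda>h. foldr difference hs (difference h f) x"])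
    show "continuous_on UNIV (\<lambda>h. foldr difference hs (difference h f) x)"
      unfolding foldr_difference_commute difference_def[of _ "foldr difference hs f"]
      by (intro continuous_intros continuous_on_compose2[OF
            continuous_on_foldr_difference[OF Suc.prems(1)]]) auto
    show "foldr difference hs (difference h f) x = 0" if "h \<in> H" for h
      using degree_less_onD[OF IH[OF that]] \<open>length hs = n\<close> by simp
  qed
  then show ?case
    unfolding degree_less_on_Suc by (simp add: degree_less_on_def)
qed

section \<open>Finite rank and finitely generated semigroups\<close>

lemma subgroup_diff: "add_subgroup F \<Longrightarrow> x \<in> F \<Longrightarrow> y \<in> F \<Longrightarrow> x - y \<in> F"
  unfolding add_subgroup_def by (metis diff_conv_add_uminus)

lemma subgroup_int_mult: "add_subgroup F \<Longrightarrow> x \<in> F \<Longrightarrow> int_mult k x \<in> F"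
  by (simp add: int_mult_def subgroup_diff subgroup_nat_mult)

lemma subgroup_sum: "add_subgroup F \<Longrightarrow> (\<And>i. i \<in> I \<Longrightarrow> g i \<in> F) \<Longrightarrow> sum g I \<in> F"
  by (induction I rule: infinite_finite_induct) (auto simp: add_subgroup_def)

text \<open>
  If \<open>h\<close> has infinite order and lies outside \<open>B\<close>, then adding it to \<open>B\<close> destroys independence, and
  \<open>h\<close> must occur in the resulting relation with a nonzero coefficient.
\<close>

lemma torsion_over_maximal_indep_system:
  assumes B: "maximal_indep_system H B" and h: "h \<in> H" and F: "add_subgroup F" "B \<subseteq> F"
  shows "\<exists>m>0. nat_mult m h \<in> F"
proof (cases "infinite_order h \<and> h \<notin> B")
  case False
  then consider m where "m > 0" "nat_mult m h = 0" | "h \<in> B"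
    unfolding infinite_order_def by blast
  then show ?thesis
  proof cases
    case 1
    then show ?thesis using F by (metis add_subgroup_def)
  next
    case 2
    then show ?thesis using F by (intro exI[of _ 1]) (auto simp: nat_mult_def)
  qed
next
  case True
  have "\<not> indep_system H (insert h B)"
    using B True by (auto simp: maximal_indep_system_def)
  then have "zmod.dependent (insert h B)"
    using B h True by (auto simp: maximal_indep_system_def indep_system_def)
  then obtain t u where t: "finite t" "t \<subseteq> insert h B" "(\<Sum>v\<in>t. int_mult (u v) v) = 0"
    and nz: "\<exists>v\<in>t. u v \<noteq> 0"
    unfolding zmod.dependent_explicit by blast
  have indep: "zmod.independent B"
    using B by (auto simp: maximal_indep_system_def indep_system_def)
  have uh: "h \<in> t \<and> u h \<noteq> 0"
  proof (rule ccontr)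
    assume *: "\<not> (h \<in> t \<and> u h \<noteq> 0)"
    have "(\<Sum>v\<in>t - {h}. int_mult (u v) v) = (\<Sum>v\<in>t. int_mult (u v) v)"
      using * t(1) by (intro sum.mono_neutral_left) auto
    then have "(\<Sum>v\<in>t - {h}. int_mult (u v) v) = 0"
      using t(3) by simp
    then have "\<forall>v\<in>t - {h}. u v = 0"
      using zmod.independentD[OF indep, of "t - {h}" u] t by auto
    then show False using nz * by auto
  qed
  have "int_mult (u h) h + (\<Sum>v\<in>t - {h}. int_mult (u v) v) = 0"
    using t uh sum.remove[of t h "\<lambda>v. int_mult (u v) v"] by simp
  then have "int_mult (u h) h = - (\<Sum>v\<in>t - {h}. int_mult (u v) v)"
    by (simp add: eq_neg_iff_add_eq_0)
  moreover have "(\<Sum>v\<in>t - {h}. int_mult (u v) v) \<in> F"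
    using F t by (intro subgroup_sum subgroup_int_mult) auto
  ultimately have mem: "int_mult (u h) h \<in> F" "- int_mult (u h) h \<in> F"
    using F by (auto simp: add_subgroup_def)
  show ?thesis
  proof (cases "u h > 0")
    case True
    then show ?thesis using mem by (intro exI[of _ "nat (u h)"]) (simp add: int_mult_def)
  next
    case False
    then show ?thesis using mem uh by (intro exI[of _ "nat (- u h)"]) (simp add: int_mult_def)
  qed
qed

lemma subsemigroup_gen_minimal:
  assumes "\<And>x y. x \<in> S \<Longrightarrow> y \<in> S \<Longrightarrow> x + y \<in> S" and "X \<subseteq> S"
  shows "subsemigroup_gen X \<subseteq> S"
proof
  fix x assume "x \<in> subsemigroup_gen X"
  then show "x \<in> S" by induction (use assms in auto)
qed

lemma subsemigroup_gen_mono: "X \<subseteq> Y \<Longrightarrow> subsemigroup_gen X \<subseteq> subsemigroup_gen Y"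
  by (rule subsemigroup_gen_minimal) (auto intro: subsemigroup_gen.intros)

lemma add_subgroup_subsemigroup_gen:
  assumes "0 \<in> X" and "\<And>x. x \<in> X \<Longrightarrow> - x \<in> X"
  shows "add_subgroup (subsemigroup_gen X)"
proof -
  have "- x \<in> subsemigroup_gen X" if "x \<in> subsemigroup_gen X" for x
    using that
  proof induction
    case (add x y)
    then have "- x + - y \<in> subsemigroup_gen X" by (blast intro: subsemigroup_gen.add)
    then show ?case by (simp add: add.commute)
  qed (auto intro: subsemigroup_gen.base assms)
  then show ?thesis
    using assms by (auto simp: add_subgroup_def intro: subsemigroup_gen.intros)
qed

lemma finite_dim_subspace_span:
  assumes "finite D" and "V \<subseteq> cfun.span D"
  shows "finite_dim_subspace (cfun.span V)"
proof -
  obtain B where B: "B \<subseteq> V" "cfun.independent B" "V \<subseteq> cfun.span B"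
    using cfun.maximal_independent_subset by blast
  then have "finite B"
    using cfun.independent_span_bound[OF assms(1), of B] assms(2) by auto
  moreover have "cfun.span V = cfun.span B"
    using B by (meson cfun.span_eq cfun.span_superset subset_trans)
  ultimately show ?thesis
    unfolding finite_dim_subspace_def by blast
qed

text \<open>
  The iterated differences of \<open>f\<close> with steps in \<open>X\<close> are finitely many, up to functions that vanish
  on \<open>S\<close>. Their span contains \<open>f\<close> and is invariant under translation by each \<open>s \<in> X\<close>, because
  \<open>g (x + s) = g x + difference s g x\<close>; hence it is invariant under the semigroup generated by \<open>X\<close>.
\<close>

lemma translates_in_finite_span:
  fixes f :: "'a::ab_group_add \<Rightarrow> 'e::complex_banach"
  assumes "finite X" "X \<subseteq> S" and add: "\<And>x y. x \<in> S \<Longrightarrow> y \<in> S \<Longrightarrow> x + y \<in> S"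
    and f: "degree_less_on S n f"
  shows "\<exists>D. finite D \<and>
    (\<forall>s\<in>subsemigroup_gen X. (\<lambda>x. if x \<in> S then f (x + s) else 0) \<in> cfun.span D)"
proof -
  define cut :: "('a \<Rightarrow> 'e) \<Rightarrow> 'a \<Rightarrow> 'e" where "cut g = (\<lambda>x. if x \<in> S then g x else 0)" for g
  define L :: "'a \<Rightarrow> ('a \<Rightarrow> 'e) \<Rightarrow> 'a \<Rightarrow> 'e" where "L s g = cut (\<lambda>x. g (x + s))" for s g
  define \<H> where "\<H> = {hs. set hs \<subseteq> X \<and> length hs \<le> n}"
  define D where "D = (\<lambda>hs. cut (foldr difference hs f)) ` \<H>"
  have "finite D"
    unfolding D_def \<H>_def by (intro finite_imageI finite_lists_length_le assms(1))
  have sub: "subsemigroup_gen X \<subseteq> S"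
    using assms by (intro subsemigroup_gen_minimal) auto
  have LD: "L s d \<in> cfun.span D" if s: "s \<in> X" and dD: "d \<in> D" for s d
  proof -
    obtain hs where hs: "set hs \<subseteq> X" "length hs \<le> n" and d: "d = cut (foldr difference hs f)"
      using dD by (auto simp: D_def \<H>_def)
    have "L s d = d + cut (foldr difference (s # hs) f)"
      using s assms(2) add
      by (auto simp: L_def d cut_def fun_eq_iff difference_def)
    moreover have "cut (foldr difference (s # hs) f) \<in> cfun.span D"
    proof (cases "length hs = n")
      case True
      have "foldr difference (s # hs) f x = 0" if "x \<in> S" for x
        using degree_less_onD[OF degree_less_on_Suc_mono[OF add f], of "s # hs" x]
          that True hs s assms(2) by auto
      then have "cut (foldr difference (s # hs) f) = 0"
        by (auto simp: cut_def fun_eq_iff)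
      then show ?thesis by (simp add: cfun.span_zero)
    next
      case False
      then have "s # hs \<in> \<H>" using hs s by (auto simp: \<H>_def)
      then show ?thesis unfolding D_def by (intro cfun.span_base imageI)
    qed
    ultimately show ?thesis using dD by (simp add: cfun.span_add cfun.span_base)
  qed
  have Lspan: "L s g \<in> cfun.span D" if "s \<in> X" "g \<in> cfun.span D" for s g
    using that(2)
  proof (induction rule: cfun.span_induct)
    case base
    have "L s 0 = 0" "L s (a + b) = L s a + L s b" "L s (fun_scaleC c a) = fun_scaleC c (L s a)" for a b c
      by (auto simp: L_def cut_def fun_eq_iff fun_scaleC_def)
    then show ?case
      by (simp add: cfun.subspace_def cfun.span_zero cfun.span_add cfun.span_scale)
  qed (use LD that(1) in auto)
  have "cut (\<lambda>x. g (x + s)) \<in> cfun.span D"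
    if "s \<in> subsemigroup_gen X" "cut g \<in> cfun.span D" for s g
    using that
  proof (induction arbitrary: g)
    case (base s)
    have "cut (\<lambda>x. g (x + s)) = L s (cut g)"
      using base assms(2) add by (auto simp: L_def cut_def fun_eq_iff)
    then show ?case using Lspan base by simp
  next
    case (add s t)
    have "cut (\<lambda>x. (\<lambda>y. g (y + t)) (x + s)) \<in> cfun.span D"
      by (intro add.IH add.prems)
    then show ?case by (simp add: add.assoc)
  qed
  moreover have "cut f \<in> D"
    by (auto simp: D_def \<H>_def intro!: image_eqI[of _ _ "[]"])
  ultimately show ?thesis
    using \<open>finite D\<close> unfolding cut_def by (blast intro: cfun.span_base)
qed

section \<open>The Hahn--Banach theorem for the norm\<close>

text \<open>
  The only form of the Hahn--Banach theorem used below is that continuous functionals separate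
  points. It follows from the fact that a minimal sublinear functional is linear.
\<close>

definition sublinear :: "('v::real_vector \<Rightarrow> real) \<Rightarrow> bool"
  where "sublinear p \<longleftrightarrow> (\<forall>x y. p (x + y) \<le> p x + p y) \<and> (\<forall>t\<ge>0. \<forall>x. p (t *\<^sub>R x) \<le> t * p x)"

lemma sublinear_add: "sublinear p \<Longrightarrow> p (x + y) \<le> p x + p y"
  and sublinear_scale_le: "sublinear p \<Longrightarrow> t \<ge> 0 \<Longrightarrow> p (t *\<^sub>R x) \<le> t * p x"
  by (simp_all add: sublinear_def)

lemma sublinear_0: assumes "sublinear p" shows "p 0 = 0"
  using sublinear_add[OF assms, of 0 0] sublinear_scale_le[OF assms, of 0 0] by simp

lemma sublinear_scale:
  assumes "sublinear p" "t \<ge> 0" shows "p (t *\<^sub>R x) = t * p x"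
proof (cases "t = 0")
  case False
  then have "p (inverse t *\<^sub>R (t *\<^sub>R x)) \<le> inverse t * p (t *\<^sub>R x)"
    using assms by (intro sublinear_scale_le) auto
  then have "t * p x \<le> p (t *\<^sub>R x)"
    using False assms by (simp add: field_simps)
  then show ?thesis using sublinear_scale_le[OF assms, of x] by simp
qed (simp add: sublinear_0[OF assms(1)])

lemma sublinear_minus: assumes "sublinear p" shows "- p (- x) \<le> p x"
  using sublinear_add[OF assms, of x "- x"] sublinear_0[OF assms] by simp

text \<open>
  The infimum over all \<open>t \<ge> 0\<close> of the right-hand side is the sublinear functional in question. For
  \<open>t = 0\<close> the inequality gives \<open>q \<le> p\<close>. For \<open>t = 1\<close> it gives \<open>q (- y) \<le> - p y\<close>, and also the
  superadditivity of \<open>p\<close> in case \<open>q = p\<close>.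
\<close>

lemma sublinear_lower:
  assumes p: "sublinear p"
  shows "\<exists>q. sublinear q \<and> (\<forall>x t. t \<ge> 0 \<longrightarrow> q x \<le> p (x + t *\<^sub>R y) - t * p y)"
proof -
  define g where "g x t = p (x + t *\<^sub>R y) - t * p y" for x t
  define q where "q x = (INF t\<in>{0..}. g x t)" for x
  have "g x t \<ge> - p (- x)" if "t \<ge> 0" for x t
    using sublinear_add[OF p, of "x + t *\<^sub>R y" "- x"] sublinear_scale[OF p that, of y]
    by (simp add: g_def)
  then have bdd: "bdd_below (g x ` {0..})" for x by (auto intro!: bdd_belowI2)
  have le: "q x \<le> g x t" if "t \<ge> 0" for x t
    unfolding q_def using bdd that by (intro cINF_lower) auto
  have greatest: "c \<le> q x" if "\<And>t. t \<ge> 0 \<Longrightarrow> c \<le> g x t" for c x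
    unfolding q_def using that by (intro cINF_greatest) auto
  have "q (x + z) \<le> q x + q z" for x z
  proof -
    have *: "q (x + z) \<le> g x s + g z t" if "s \<ge> 0" "t \<ge> 0" for s t
    proof -
      have "q (x + z) \<le> g (x + z) (s + t)" using that by (intro le) simp
      also have "\<dots> \<le> g x s + g z t"
        using sublinear_add[OF p, of "x + s *\<^sub>R y" "z + t *\<^sub>R y"]
        by (simp add: g_def algebra_simps)
      finally show ?thesis .
    qed
    have "q (x + z) - g x s \<le> q z" if "s \<ge> 0" for s
      by (rule greatest) (use *[OF that] in \<open>simp add: algebra_simps\<close>)
    then have "q (x + z) - q z \<le> q x"
      by (intro greatest) (simp add: algebra_simps)
    then show ?thesis by simp
  qed
  moreover have "q (c *\<^sub>R x) \<le> c * q x" if "c \<ge> 0" for c x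
  proof (cases "c = 0")
    case True
    then show ?thesis using le[of 0 0] sublinear_0[OF p] by (simp add: g_def)
  next
    case False
    then have c: "c > 0" using that by simp
    have "q (c *\<^sub>R x) / c \<le> q x"
    proof (rule greatest)
      fix t :: real assume t: "t \<ge> 0"
      have "q (c *\<^sub>R x) \<le> g (c *\<^sub>R x) (c * t)" using c t by (intro le) simp
      also have "\<dots> = c * g x t"
        using sublinear_scale[OF p that, of "x + t *\<^sub>R y"] by (simp add: g_def algebra_simps)
      finally show "q (c *\<^sub>R x) / c \<le> g x t" using c by (simp add: field_simps)
    qed
    then show ?thesis using c by (simp add: field_simps)
  qed
  ultimately have "sublinear q" by (simp add: sublinear_def)
  then show ?thesis using le unfolding g_def by blast
qed

lemma sublinear_chain_Inf:
  assumes C: "C \<noteq> {}" "\<And>p. p \<in> C \<Longrightarrow> sublinear p" "\<And>p x. p \<in> C \<Longrightarrow> p x \<le> p0 x"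
    and chain: "\<And>p q. p \<in> C \<Longrightarrow> q \<in> C \<Longrightarrow> p \<le> q \<or> q \<le> p"
  shows "\<exists>u. sublinear u \<and> (\<forall>p\<in>C. u \<le> p)"
proof -
  define u where "u x = (INF p\<in>C. p x)" for x
  have "bdd_below ((\<lambda>p. p x) ` C)" for x
  proof (rule bdd_belowI2)
    fix p assume "p \<in> C"
    then show "- p0 (- x) \<le> p x"
      using C(3)[of p "- x"] sublinear_minus[OF C(2), of p x] by simp
  qed
  then have le: "u x \<le> p x" if "p \<in> C" for x p
    unfolding u_def using that by (intro cINF_lower) auto
  have greatest: "c \<le> u x" if "\<And>p. p \<in> C \<Longrightarrow> c \<le> p x" for c x
    unfolding u_def using that C(1) by (intro cINF_greatest) auto
  have "u (x + y) \<le> u x + u y" for x y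
  proof -
    have *: "u (x + y) \<le> p x + q y" if pq: "p \<in> C" "q \<in> C" for p q
    proof -
      obtain r where r: "r \<in> C" "r \<le> p" "r \<le> q" using chain[OF pq] pq by (metis order_refl)
      have "u (x + y) \<le> r x + r y"
        using le[OF r(1)] sublinear_add[OF C(2)[OF r(1)]] by (rule order_trans)
      also have "\<dots> \<le> p x + q y" using r by (intro add_mono) (auto simp: le_fun_def)
      finally show ?thesis .
    qed
    have "u (x + y) - p x \<le> u y" if "p \<in> C" for p
      by (rule greatest) (use *[OF that] in \<open>simp add: algebra_simps\<close>)
    then have "u (x + y) - u y \<le> u x" by (intro greatest) (simp add: algebra_simps)
    then show ?thesis by simp
  qed
  moreover have "u (t *\<^sub>R x) \<le> t * u x" if t: "t \<ge> 0" for t x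
  proof (cases "t = 0")
    case True
    obtain p where p: "p \<in> C" using C(1) by blast
    then show ?thesis using True le[OF p, of 0] sublinear_0[OF C(2)[OF p]] by simp
  next
    case False
    then have "u (t *\<^sub>R x) / t \<le> u x"
    proof (intro greatest)
      fix p assume "p \<in> C"
      then show "u (t *\<^sub>R x) / t \<le> p x"
        using le[of p "t *\<^sub>R x"] sublinear_scale[OF C(2) t, of p x] False t by (simp add: field_simps)
    qed
    then show ?thesis using False t by (simp add: field_simps)
  qed
  ultimately have "sublinear u" by (simp add: sublinear_def)
  then show ?thesis using le by (auto simp: le_fun_def)
qed

text \<open>
  A minimal element \<open>p\<close> below \<open>p0\<close> exists by Zorn's lemma. Minimality forces the functional that
  \<open>sublinear_lower\<close> puts below \<open>p\<close> to be \<open>p\<close> itself, so \<open>p\<close> is superadditive and thus linear.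
\<close>

lemma linear_below_sublinear:
  assumes p0: "sublinear p0"
  shows "\<exists>\<phi>. linear \<phi> \<and> (\<forall>x. \<phi> x \<le> p0 x)"
proof -
  define A where "A = {p. sublinear p \<and> p \<le> p0}"
  have "\<exists>m\<in>A. \<forall>a\<in>A. a \<le> m \<longrightarrow> a = m"
  proof (rule predicate_Zorn[where P = "\<lambda>p q. q \<le> p"])
    show "partial_order_on A (relation_of (\<lambda>p q. q \<le> p) A)"
      by (rule partial_order_on_relation_ofI) auto
    show "\<exists>u\<in>A. \<forall>a\<in>C. u \<le> a" if "C \<in> Chains (relation_of (\<lambda>p q. q \<le> p) A)" for C
    proof (cases "C = {}")
      case True
      then show ?thesis using p0 by (auto simp: A_def)
    next
      case False
      have CA: "C \<subseteq> A" using Chains_relation_of[OF that] .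
      have "\<exists>u. sublinear u \<and> (\<forall>p\<in>C. u \<le> p)"
      proof (rule sublinear_chain_Inf[OF False])
        show "p \<le> q \<or> q \<le> p" if "p \<in> C" "q \<in> C" for p q
          using \<open>C \<in> Chains _\<close> that by (auto simp: Chains_def relation_of_def)
        show "sublinear p" "p x \<le> p0 x" if "p \<in> C" for p x
          using CA that by (auto simp: A_def le_fun_def)
      qed
      then obtain u where u: "sublinear u" "\<forall>p\<in>C. u \<le> p" by blast
      obtain p where "p \<in> C" using False by blast
      then have "u \<le> p0" using CA u(2) by (auto simp: A_def intro: order_trans)
      then show ?thesis using u by (auto simp: A_def)
    qed
  qed
  then obtain p where p: "sublinear p" "p \<le> p0"
    and min: "\<And>q. sublinear q \<Longrightarrow> q \<le> p \<Longrightarrow> q = p"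
    unfolding A_def by (auto dest: order_trans)
  have super: "p x + p y \<le> p (x + y)" for x y
  proof -
    obtain q where q: "sublinear q" "\<And>x t. t \<ge> 0 \<Longrightarrow> q x \<le> p (x + t *\<^sub>R y) - t * p y"
      using sublinear_lower[OF p(1)] by blast
    have "q = p" using q(2)[of 0] by (intro min q(1)) (simp add: le_fun_def)
    then show ?thesis using q(2)[of 1 x] by simp
  qed
  have add: "p (x + y) = p x + p y" for x y
    using super sublinear_add[OF p(1)] by (simp add: antisym)
  have "p (- x) = - p x" for x
    using add[of x "- x"] sublinear_0[OF p(1)] by simp
  then have "p (t *\<^sub>R x) = t * p x" for t x
    using sublinear_scale[OF p(1), of t x] sublinear_scale[OF p(1), of "- t" "x"]
    by (cases "t \<ge> 0") auto
  then have "linear p" using add by (intro linearI) auto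
  then show ?thesis using p(2) by (auto simp: le_fun_def)
qed

lemma norming_functional:
  fixes x0 :: "'v::real_normed_vector"
  shows "\<exists>\<phi>. bounded_linear \<phi> \<and> norm x0 \<le> (\<phi> x0 :: real)"
proof -
  have "sublinear (norm :: 'v \<Rightarrow> real)"
    by (auto simp: sublinear_def norm_triangle_ineq)
  \<comment> \<open>Lowering the norm in the direction of \<open>x0\<close> fixes the value at \<open>- x0\<close> before linearity is achieved.\<close>
  then obtain q where q: "sublinear q" "\<And>x t. t \<ge> 0 \<Longrightarrow> q x \<le> norm (x + t *\<^sub>R x0) - t * norm x0"
    using sublinear_lower by blast
  obtain \<phi> where \<phi>: "linear \<phi>" "\<And>x. \<phi> x \<le> q x" using linear_below_sublinear[OF q(1)] by blast
  have le: "\<phi> x \<le> norm x" for x using order_trans[OF \<phi>(2) q(2)[of 0 x]] by simp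
  have "\<bar>\<phi> x\<bar> \<le> norm x" for x
    using le[of x] le[of "- x"] linear_neg[OF \<phi>(1)] by simp
  then have "bounded_linear \<phi>"
    using \<phi>(1) by (intro bounded_linear_intro[where K = 1]) (auto simp: linear_add linear_cmul)
  moreover have "\<phi> (- x0) \<le> - norm x0" using order_trans[OF \<phi>(2) q(2)[of 1 "- x0"]] by simp
  ultimately show ?thesis using linear_neg[OF \<phi>(1)] by auto
qed

lemma bounded_linear_scaleC: "bounded_linear (\<lambda>x. c *\<^sub>C x :: 'e::complex_banach)"
proof (rule bounded_linear_intro[where K = "cmod c"])
  show "c *\<^sub>C r *\<^sub>R x = r *\<^sub>R c *\<^sub>C x" for r and x :: 'e
    by (simp flip: scaleC_of_real add: scaleC_scaleC mult.commute)
qed (simp_all add: scaleC_add_right norm_scaleC mult.commute)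

text \<open>
  A complex linear functional is determined by its real part \<open>\<phi>\<close>, as \<open>u x = \<phi> x - \<i> * \<phi> (\<i> *\<^sub>C x)\<close>,
  and every bounded real linear functional arises in this way.
\<close>

lemma dual_space_complexify:
  fixes \<phi> :: "'e::complex_banach \<Rightarrow> real"
  assumes "bounded_linear \<phi>"
  shows "\<exists>u\<in>dual_space. \<forall>x. Re (u x) = \<phi> x"
proof -
  interpret bounded_linear \<phi> by fact
  define u where "u x = Complex (\<phi> x) (- \<phi> (\<i> *\<^sub>C x))" for x
  have dec: "c *\<^sub>C x = Re c *\<^sub>R x + Im c *\<^sub>R \<i> *\<^sub>C x" for c and x :: 'e
  proof -
    have "c *\<^sub>C x = (complex_of_real (Re c) + complex_of_real (Im c) * \<i>) *\<^sub>C x"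
      by (rule arg_cong[where f = "\<lambda>c. c *\<^sub>C x"]) (simp add: complex_eq_iff)
    then show ?thesis
      by (simp only: scaleC_add_left scaleC_of_real flip: scaleC_scaleC)
  qed
  have neg: "\<i> *\<^sub>C \<i> *\<^sub>C x = - x" for x :: 'e
    using scaleC_of_real[of "-1" x] by (simp add: scaleC_scaleC)
  have "Vector_Spaces.linear scaleC (*) u"
  proof
    show "u (x + y) = u x + u y" for x y
      by (simp add: u_def scaleC_add_right add complex_eq_iff)
    show "u (c *\<^sub>C x) = c * u x" for c x
    proof -
      have \<phi>c: "\<phi> (c *\<^sub>C x) = Re c * \<phi> x + Im c * \<phi> (\<i> *\<^sub>C x)" for x
        by (simp add: dec[of c] add scaleR)
      have "\<phi> (\<i> *\<^sub>C c *\<^sub>C x) = \<phi> (c *\<^sub>C \<i> *\<^sub>C x)"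
        by (simp add: scaleC_scaleC mult.commute)
      also have "\<dots> = Re c * \<phi> (\<i> *\<^sub>C x) - Im c * \<phi> x"
        unfolding \<phi>c neg by (simp add: linear_neg[OF linear_axioms])
      finally show ?thesis by (simp add: u_def complex_eq_iff \<phi>c)
    qed
  qed
  moreover have "continuous_on UNIV u"
  proof -
    have "continuous_on UNIV (\<lambda>x. \<phi> (\<i> *\<^sub>C x))"
      by (rule linear_continuous_on[OF bounded_linear_compose[OF assms bounded_linear_scaleC]])
    then have "continuous_on UNIV (\<lambda>x. complex_of_real (\<phi> x) - \<i> * complex_of_real (\<phi> (\<i> *\<^sub>C x)))"
      by (intro continuous_on_diff continuous_on_mult continuous_on_const continuous_on_of_real
            linear_continuous_on[OF assms])
    also have "(\<lambda>x. complex_of_real (\<phi> x) - \<i> * complex_of_real (\<phi> (\<i> *\<^sub>C x))) = u"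
      by (simp add: u_def fun_eq_iff complex_eq_iff)
    finally show ?thesis .
  qed
  ultimately show ?thesis
    by (intro bexI[of _ u]) (simp_all add: dual_space_def u_def)
qed

lemma dual_space_separates:
  assumes "x \<noteq> (0::'e::complex_banach)"
  shows "\<exists>u\<in>dual_space. u x \<noteq> 0"
proof -
  obtain \<phi> where \<phi>: "bounded_linear \<phi>" "norm x \<le> \<phi> x" using norming_functional by blast
  then have "\<phi> x \<noteq> 0" using assms by auto
  moreover obtain u where "u \<in> dual_space" "Re (u x) = \<phi> x"
    using dual_space_complexify[OF \<phi>(1)] by blast
  ultimately show ?thesis by (metis zero_complex.simps(1))
qed

section \<open>Weak polynomials have bounded degree\<close>

lemma ex_degree_less_add:
  assumes "\<exists>n. degree_less_on UNIV n f" "\<exists>n. degree_less_on UNIV n g"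
  shows "\<exists>n. degree_less_on UNIV n (\<lambda>x. f x + g x)"
proof -
  obtain m n where "degree_less_on UNIV m f" "degree_less_on UNIV n g" using assms by blast
  then have "degree_less_on UNIV (max m n) (\<lambda>x. f x + g x)"
    by (intro degree_less_on_add) (auto elim: degree_less_mono)
  then show ?thesis ..
qed

lemma ex_degree_less_sum:
  "(\<And>i. i \<in> I \<Longrightarrow> \<exists>n. degree_less_on UNIV n (f i)) \<Longrightarrow> \<exists>n. degree_less_on UNIV n (\<lambda>x. \<Sum>i\<in>I. f i x)"
proof (induction I rule: infinite_finite_induct)
  case (insert i I)
  then show ?case using ex_degree_less_add[of "f i" "\<lambda>x. \<Sum>i\<in>I. f i x"] by simp
qed (simp_all, (intro exI degree_less_zero)+)

lemma ex_degree_less_prod: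
  fixes f :: "'i \<Rightarrow> 'a::ab_semigroup_add \<Rightarrow> 'r::comm_ring_1"
  shows "(\<And>i. i \<in> I \<Longrightarrow> \<exists>n. degree_less_on UNIV n (f i)) \<Longrightarrow> \<exists>n. degree_less_on UNIV n (\<lambda>x. \<Prod>i\<in>I. f i x)"
proof (induction I rule: infinite_finite_induct)
  case (insert i I)
  obtain m where m: "degree_less_on UNIV m (f i)"
    using insert.prems[of i] by blast
  obtain n where n: "degree_less_on UNIV n (\<lambda>x. \<Prod>i\<in>I. f i x)"
    using insert.IH insert.prems by blast
  have "(\<lambda>x. \<Prod>i\<in>insert i I. f i x) = (\<lambda>x. f i x * (\<Prod>i\<in>I. f i x))"
    using insert.hyps by simp
  then show ?case using degree_less_mult[OF m n] by metis
next
  case (infinite A)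
  then show ?case using degree_less_const[of 1] by (intro exI[of _ 1]) simp
next
  case empty
  then show ?case using degree_less_const[of 1] by (intro exI[of _ 1]) simp
qed

lemma complex_polynomial_imp_degree_less:
  assumes "complex_polynomial f"
  shows "\<exists>n. degree_less_on UNIV n f"
proof -
  obtain n a P where a: "\<And>i. i < n \<Longrightarrow> Modules.additive (a i)" and P: "mpoly_vars P \<subseteq> {..<n}"
    and f: "f = (\<lambda>x. mpoly_eval P (\<lambda>i. a i x))"
    using assms unfolding complex_polynomial_def by blast
  have mon: "\<exists>k. degree_less_on UNIV k (\<lambda>x. \<Prod>i\<in>Poly_Mapping.keys m. a i x ^ Poly_Mapping.lookup m i)"
    if "m \<in> Poly_Mapping.keys P" for m
  proof (rule ex_degree_less_prod)
    fix i assume "i \<in> Poly_Mapping.keys m"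
    then have "i < n" using P that by (auto simp: mpoly_vars_def)
    then have "\<exists>k. degree_less_on UNIV k (\<lambda>x. \<Prod>j<Poly_Mapping.lookup m i. a i x)"
      using degree_less_additive[OF a] by (intro ex_degree_less_prod) blast
    then show "\<exists>k. degree_less_on UNIV k (\<lambda>x. a i x ^ Poly_Mapping.lookup m i)"
      by simp
  qed
  have "\<exists>k. degree_less_on UNIV k (\<lambda>x. Poly_Mapping.lookup P m *
      (\<Prod>i\<in>Poly_Mapping.keys m. a i x ^ Poly_Mapping.lookup m i))"
    if m: "m \<in> Poly_Mapping.keys P" for m
  proof -
    obtain k where "degree_less_on UNIV k (\<lambda>x. \<Prod>i\<in>Poly_Mapping.keys m. a i x ^ Poly_Mapping.lookup m i)"
      using m mon by blast
    from degree_less_mult[OF degree_less_const this] show ?thesis by (rule exI)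
  qed
  then show ?thesis
    unfolding f mpoly_eval_def by (rule ex_degree_less_sum)
qed

text \<open>
  The functionals \<open>\<phi>\<close> for which \<open>\<phi> \<circ> f\<close> has degree less than \<open>n\<close> form a closed subspace of the dual
  space. These subspaces exhaust the dual space, so by the Baire category theorem one of them has
  interior points and is therefore the whole space. As functionals separate points, this \<open>n\<close> bounds
  the degree of \<open>f\<close>.
\<close>

lemma degree_less_of_functionals:
  fixes f :: "'a::ab_semigroup_add \<Rightarrow> 'e::real_normed_vector"
  assumes f: "\<And>\<phi>. bounded_linear \<phi> \<Longrightarrow> \<exists>n. degree_less_on UNIV n (\<lambda>x. \<phi> (f x) :: real)"
  shows "\<exists>n. degree_less_on UNIV n f"
proof -
  define A :: "nat \<Rightarrow> ('e \<Rightarrow>\<^sub>L real) set"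
    where "A n = {\<phi>. degree_less_on UNIV n (\<lambda>x. blinfun_apply \<phi> (f x))}" for n
  have A: "\<phi> \<in> A n \<longleftrightarrow> (\<forall>hs x. length hs = n \<longrightarrow> blinfun_apply \<phi> (foldr difference hs f x) = 0)" for \<phi> n
  proof -
    have "Modules.additive (blinfun_apply \<phi>)"
      unfolding Modules.additive_def by (simp add: blinfun.add_right)
    then have "foldr difference hs (\<lambda>x. blinfun_apply \<phi> (f x)) x = blinfun_apply \<phi> (foldr difference hs f x)" for hs x
      by (simp add: foldr_difference_additive_compose)
    then show ?thesis
      unfolding A_def degree_less_on_def by simp
  qed
  have "closed (A n)" for n
  proof -
    have "A n = (\<Inter>hs\<in>{hs. length hs = n}. \<Inter>x. {\<phi>. blinfun_apply \<phi> (foldr difference hs f x) = 0})"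
      using A by auto
    then show ?thesis
      by (auto intro!: closed_INT closed_Collect_eq continuous_intros)
  qed
  moreover have "\<Union>(range A) = UNIV"
    using f[OF blinfun.bounded_linear_right] by (auto simp: A_def)
  ultimately have "\<exists>n. interior (A n) \<noteq> {}"
    using Baire_category_alt[of "euclidean :: ('e \<Rightarrow>\<^sub>L real) topology" "range A"]
      completely_metrizable_space_euclidean[where 'a = "'e \<Rightarrow>\<^sub>L real"]
    by auto
  then obtain n \<phi>0 e where e: "e > 0" "ball \<phi>0 e \<subseteq> A n"
    by (metis ex_in_conv mem_interior)
  have "blinfun_apply \<phi> v = 0" if v: "v = foldr difference hs f x" "length hs = n" for \<phi> :: "'e \<Rightarrow>\<^sub>L real" and hs x v
  proof -
    \<comment> \<open>A multiple of \<open>\<phi>\<close> that is small enough to stay in the ball around \<open>\<phi>0\<close>.\<close>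
    define c where "c = e / (2 * (norm \<phi> + 1))"
    have pos: "2 * (norm \<phi> + 1) > 0" by (smt (verit) norm_ge_zero)
    then have c: "c > 0" using e by (simp add: c_def)
    have "c * norm \<phi> < c * (2 * (norm \<phi> + 1))"
      using c by (intro mult_strict_left_mono) (smt (verit) norm_ge_zero)+
    also have "\<dots> = e" using pos by (simp add: c_def)
    finally have "\<phi>0 + c *\<^sub>R \<phi> \<in> A n" "\<phi>0 \<in> A n"
      using c e by (auto simp: dist_norm intro!: subsetD[OF e(2)])
    then have "blinfun_apply (\<phi>0 + c *\<^sub>R \<phi>) v = 0" "blinfun_apply \<phi>0 v = 0"
      unfolding A v(1) using v(2) by blast+
    then show ?thesis using c by (simp add: blinfun.add_left blinfun.scaleR_left)
  qed
  note vanish = this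
  have "foldr difference hs f x = 0" if hs: "length hs = n" for hs x
  proof -
    define v where "v = foldr difference hs f x"
    obtain \<phi> where \<phi>: "bounded_linear \<phi>" "norm v \<le> \<phi> v"
      using norming_functional[of v] by blast
    have "blinfun_apply (Blinfun \<phi>) v = 0" using vanish[OF v_def hs] .
    then have "norm v \<le> 0" using \<phi> by (simp add: bounded_linear_Blinfun_apply)
    then show ?thesis by (simp add: v_def)
  qed
  then show ?thesis unfolding degree_less_on_def by blast
qed

lemma w_polynomial_imp_degree_less:
  fixes f :: "'a::topological_ab_group_add \<Rightarrow> 'e::complex_banach"
  assumes "w_polynomial f"
  shows "\<exists>n. degree_less_on UNIV n f"
proof (rule degree_less_of_functionals)
  fix \<phi> :: "'e \<Rightarrow> real" assume "bounded_linear \<phi>"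
  then obtain u where u: "u \<in> dual_space" "\<And>x. Re (u x) = \<phi> x"
    using dual_space_complexify by blast
  then have "complex_polynomial (u \<circ> f)"
    using assms by (simp add: w_polynomial_def)
  then obtain n where "degree_less_on UNIV n (u \<circ> f)"
    using complex_polynomial_imp_degree_less by blast
  then have "degree_less_on UNIV n (\<lambda>x. Re ((u \<circ> f) x))"
    by (rule degree_less_on_additive_compose[rotated]) (simp add: Modules.additive_def)
  then show "\<exists>n. degree_less_on UNIV n (\<lambda>x. \<phi> (f x))" using u(2) by auto
qed

section \<open>Translates in the closure of a finite-dimensional space\<close>

text \<open>
  Continuity refers to the topology of pointwise convergence on the space of functions.
\<close>

definition continuous_functional :: "(('a \<Rightarrow> 'e::complex_banach) \<Rightarrow> complex) \<Rightarrow> bool"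
  where "continuous_functional l \<longleftrightarrow> continuous_on UNIV l \<and>
    (\<forall>g h. l (g + h) = l g + l h) \<and> (\<forall>c g. l (fun_scaleC c g) = c * l g)"

text \<open>
  Finite-dimensional spaces of functions are closed under pointwise convergence, in the form of a
  separation statement. Induction on \<open>B\<close> reduces it to separating one vector from \<open>0\<close>: given \<open>l\<close>
  that vanishes on \<open>B\<close> with \<open>l b = 1\<close>, projecting along \<open>b\<close> onto the kernel of \<open>l\<close> removes \<open>b\<close>
  without leaving the complement of the span of \<open>B\<close>.
\<close>

lemma separate_from_finite_span:
  fixes B :: "('a \<Rightarrow> 'e::complex_banach) set"
  assumes "finite B" "F \<notin> cfun.span B"
  shows "\<exists>l. continuous_functional l \<and> (\<forall>g\<in>cfun.span B. l g = 0) \<and> l F = 1"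
  using assms
proof (induction arbitrary: F)
  case empty
  then obtain x where "F x \<noteq> 0" by (auto simp: fun_eq_iff)
  then obtain u where u: "u \<in> dual_space" "u (F x) \<noteq> 0" using dual_space_separates by blast
  have u_add: "u (a + b) = u a + u b" and u_scale: "u (c *\<^sub>C a) = c * u a" for a b c
    using u(1) by (simp_all add: dual_space_def Vector_Spaces.linear_iff)
  define l where "l g = u (g x) / u (F x)" for g :: "'a \<Rightarrow> 'e"
  have "continuous_on UNIV (\<lambda>g :: 'a \<Rightarrow> 'e. u (g x))"
    by (rule continuous_on_compose2[of UNIV u]) (use u(1) in \<open>auto simp: dual_space_def\<close>)
  then have "continuous_on UNIV l"
    unfolding l_def by (rule continuous_on_divide[OF _ continuous_on_const]) (simp add: u(2))
  moreover have "l (g + h) = l g + l h" "l (fun_scaleC c g) = c * l g" for g h c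
    by (simp_all add: l_def fun_scaleC_def u_add u_scale add_divide_distrib)
  ultimately have "continuous_functional l" by (simp add: continuous_functional_def)
  moreover have "\<forall>g\<in>cfun.span {}. l g = 0"
    using u_scale[of 0 0] by (simp add: l_def)
  moreover have "l F = 1" using u(2) by (simp add: l_def)
  ultimately show ?case by blast
next
  case (insert b B)
  show ?case
  proof (cases "b \<in> cfun.span B")
    case True
    then show ?thesis using insert by (simp add: cfun.span_redundant)
  next
    case False
    obtain l where l: "continuous_functional l" "\<And>g. g \<in> cfun.span B \<Longrightarrow> l g = 0" "l b = 1"
      using insert.IH[OF False] by blast
    define F' where "F' = F - fun_scaleC (l F) b"
    have "F' \<notin> cfun.span B"
      using insert.prems unfolding F'_def cfun.span_breakdown_eq by blast
    then obtain k where k: "continuous_functional k" "\<And>g. g \<in> cfun.span B \<Longrightarrow> k g = 0" "k F' = 1"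
      using insert.IH by blast
    define m where "m g = k g - l g * k b" for g
    have diff: "j (g - fun_scaleC c b) = j g - c * j b" if "continuous_functional j" for j g c
    proof -
      have "j g = j (g - fun_scaleC c b) + j (fun_scaleC c b)"
        using that unfolding continuous_functional_def by (metis diff_add_cancel)
      then show ?thesis using that by (simp add: continuous_functional_def)
    qed
    have "continuous_functional m"
      using l(1) k(1) unfolding continuous_functional_def m_def
      by (auto simp: algebra_simps intro!: continuous_intros)
    moreover have "m g = 0" if g: "g \<in> cfun.span (insert b B)" for g
    proof -
      obtain c where "g - fun_scaleC c b \<in> cfun.span B"
        using g cfun.span_breakdown_eq by blast
      then have "l g - c * l b = 0" "k g - c * k b = 0"
        using l k diff by metis+
      then show ?thesis using l(3) by (simp add: m_def)
    qed
    moreover have "m F = 1"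
      using k(3) diff[OF k(1), of F "l F"] by (simp add: m_def F'_def)
    ultimately show ?thesis by blast
  qed
qed

lemma degree_less_functional_translate:
  fixes f :: "'a::ab_group_add \<Rightarrow> 'e::complex_banach"
  assumes l: "continuous_functional l"
  shows "degree_less_on UNIV n f \<Longrightarrow> degree_less_on UNIV n (\<lambda>g. l (\<lambda>x. f (x + g)))"
proof (induction n arbitrary: f)
  case 0
  then have "(\<lambda>x. f (x + g)) = fun_scaleC 0 f" for g
    by (auto simp: degree_less_on_0 fun_eq_iff fun_scaleC_def)
  moreover have "l (fun_scaleC 0 f) = 0"
    using l unfolding continuous_functional_def by (metis mult_zero_left)
  ultimately show ?case by (simp add: degree_less_on_0)
next
  case (Suc n)
  have "difference h (\<lambda>g. l (\<lambda>x. f (x + g))) = (\<lambda>g. l (\<lambda>x. difference h f (x + g)))" for h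
  proof
    fix g
    have "l ((\<lambda>x. difference h f (x + g)) + (\<lambda>x. f (x + g))) =
        l (\<lambda>x. difference h f (x + g)) + l (\<lambda>x. f (x + g))"
      using l by (simp add: continuous_functional_def)
    moreover have "(\<lambda>x. difference h f (x + g)) + (\<lambda>x. f (x + g)) = (\<lambda>x. f (x + (g + h)))"
      by (simp add: fun_eq_iff difference_def add.assoc)
    ultimately show "difference h (\<lambda>g. l (\<lambda>x. f (x + g))) g = l (\<lambda>x. difference h f (x + g))"
      by (simp add: difference_def)
  qed
  then show ?case using Suc by (simp add: degree_less_on_Suc)
qed

text \<open>
  A functional \<open>l\<close> separating a translate of \<open>f\<close> from the span of \<open>D\<close> would turn the translates of \<open>f\<close>
  into a continuous scalar function \<open>q\<close> of finite degree. It would vanish on \<open>F\<close>, hence on \<open>H\<close> by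
  uniqueness, hence everywhere by density.
\<close>

lemma translates_in_span_from_dense_torsion:
  fixes f :: "'a::topological_ab_group_add \<Rightarrow> 'e::complex_banach"
  assumes H: "add_subgroup H" "closure H = UNIV" and F: "add_subgroup F" "F \<subseteq> H"
    and tor: "\<And>x. x \<in> H \<Longrightarrow> \<exists>m>0. nat_mult m x \<in> F"
    and f: "continuous_on UNIV f" "degree_less_on UNIV N f"
    and D: "finite D" "\<And>y. y \<in> F \<Longrightarrow> (\<lambda>x. f (x + y)) \<in> cfun.span D"
  shows "(\<lambda>x. f (x + g)) \<in> cfun.span D"
proof (rule ccontr)
  assume "(\<lambda>x. f (x + g)) \<notin> cfun.span D"
  then obtain l where l: "continuous_functional l" "\<And>d. d \<in> cfun.span D \<Longrightarrow> l d = 0"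
      "l (\<lambda>x. f (x + g)) = 1"
    using separate_from_finite_span[OF D(1)] by blast
  define q where "q y = l (\<lambda>x. f (x + y))" for y
  have "degree_less_on UNIV N q"
    unfolding q_def by (rule degree_less_functional_translate[OF l(1) f(2)])
  then have "degree_less_on H N q" by (rule degree_less_on_subset) simp
  moreover have "degree_less_on F 0 q"
    using l(2) D(2) by (simp add: degree_less_on_0 q_def)
  ultimately have "degree_less_on H 0 q"
    using degree_less_on_torsion_extension[OF H(1) F tor] by blast
  moreover have "continuous_on UNIV q"
  proof -
    have "continuous_on UNIV (\<lambda>y x. f (x + y))"
      by (intro continuous_on_coordinatewise_then_product continuous_on_compose2[OF f(1)] continuous_intros) auto
    then show ?thesis
      unfolding q_def by (rule continuous_on_compose2[of UNIV l, rotated])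
        (use l(1) in \<open>auto simp: continuous_functional_def\<close>)
  qed
  ultimately have "q g = 0"
    using zero_on_dense[OF _ H(2)] by (auto simp: degree_less_on_0)
  then show False using l(3) by (simp add: q_def)
qed

section \<open>Polynomials in given functions\<close>

definition mpoly_functions :: "nat \<Rightarrow> (nat \<Rightarrow> 'a \<Rightarrow> complex) \<Rightarrow> ('a \<Rightarrow> complex) set"
  where "mpoly_functions n a = {f. \<exists>P. mpoly_vars P \<subseteq> {..<n} \<and> f = (\<lambda>x. mpoly_eval P (\<lambda>i. a i x))}"

lemma mpoly_eval_superset:
  assumes "finite M" "Poly_Mapping.keys P \<subseteq> M"
  shows "mpoly_eval P v = (\<Sum>m\<in>M. Poly_Mapping.lookup P m *
      (\<Prod>i\<in>Poly_Mapping.keys m. v i ^ Poly_Mapping.lookup m i))"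
  unfolding mpoly_eval_def
  by (rule sum.mono_neutral_left) (use assms in \<open>auto simp: in_keys_iff\<close>)

lemma mpoly_eval_add: "mpoly_eval (P + Q) v = mpoly_eval P v + mpoly_eval Q v"
proof -
  have "finite (Poly_Mapping.keys P \<union> Poly_Mapping.keys Q)" by simp
  then show ?thesis
    by (simp add: mpoly_eval_superset[of "Poly_Mapping.keys P \<union> Poly_Mapping.keys Q"]
        Poly_Mapping.keys_add lookup_add algebra_simps sum.distrib)
qed

lemma mpoly_functions_add:
  assumes "f \<in> mpoly_functions n a" "g \<in> mpoly_functions n a"
  shows "(\<lambda>x. f x + g x) \<in> mpoly_functions n a"
proof -
  obtain P Q where PQ: "mpoly_vars P \<subseteq> {..<n}" "mpoly_vars Q \<subseteq> {..<n}"
    "f = (\<lambda>x. mpoly_eval P (\<lambda>i. a i x))" "g = (\<lambda>x. mpoly_eval Q (\<lambda>i. a i x))"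
    using assms unfolding mpoly_functions_def by blast
  have "mpoly_vars (P + Q) \<subseteq> {..<n}"
    using PQ(1,2) Poly_Mapping.keys_add[of P Q] unfolding mpoly_vars_def by blast
  then show ?thesis
    unfolding mpoly_functions_def using PQ(3,4) by (auto simp: mpoly_eval_add intro!: exI[of _ "P + Q"])
qed

lemma mpoly_functions_monomial:
  assumes "Poly_Mapping.keys m \<subseteq> {..<n}"
  shows "(\<lambda>x. c * (\<Prod>i<n. a i x ^ Poly_Mapping.lookup m i)) \<in> mpoly_functions n a"
proof -
  have "(\<Prod>i<n. a i x ^ Poly_Mapping.lookup m i) = (\<Prod>i\<in>Poly_Mapping.keys m. a i x ^ Poly_Mapping.lookup m i)" for x
    by (rule prod.mono_neutral_right) (use assms in \<open>auto simp: in_keys_iff\<close>)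
  then have "(\<lambda>x. c * (\<Prod>i<n. a i x ^ Poly_Mapping.lookup m i)) = (\<lambda>x. mpoly_eval (Poly_Mapping.single m c) (\<lambda>i. a i x))"
    by (simp add: mpoly_eval_superset[of "{m}"])
  moreover have "mpoly_vars (Poly_Mapping.single m c) \<subseteq> {..<n}"
    using assms by (auto simp: mpoly_vars_def)
  ultimately show ?thesis unfolding mpoly_functions_def by blast
qed

lemma mpoly_functions_const: "(\<lambda>x. c) \<in> mpoly_functions n a"
  using mpoly_functions_monomial[of 0 n c a] by simp

lemma mpoly_functions_sum:
  "(\<And>i. i \<in> I \<Longrightarrow> f i \<in> mpoly_functions n a) \<Longrightarrow> (\<lambda>x. \<Sum>i\<in>I. f i x) \<in> mpoly_functions n a"
  by (induction I rule: infinite_finite_induct)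
     (simp_all add: mpoly_functions_const mpoly_functions_add)

lemma mpoly_functions_expand:
  assumes "f \<in> mpoly_functions n a"
  shows "\<exists>M c. finite M \<and> (\<forall>m\<in>M. Poly_Mapping.keys m \<subseteq> {..<n}) \<and>
    f = (\<lambda>x. \<Sum>m\<in>M. c m * (\<Prod>i<n. a i x ^ Poly_Mapping.lookup m i))"
proof -
  obtain P where P: "mpoly_vars P \<subseteq> {..<n}" "f = (\<lambda>x. mpoly_eval P (\<lambda>i. a i x))"
    using assms unfolding mpoly_functions_def by blast
  have keys: "Poly_Mapping.keys m \<subseteq> {..<n}" if "m \<in> Poly_Mapping.keys P" for m
    using P(1) that by (auto simp: mpoly_vars_def)
  have "(\<Prod>i\<in>Poly_Mapping.keys m. a i x ^ Poly_Mapping.lookup m i) = (\<Prod>i<n. a i x ^ Poly_Mapping.lookup m i)"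
    if "m \<in> Poly_Mapping.keys P" for m x
    by (rule prod.mono_neutral_left) (use keys[OF that] in \<open>auto simp: in_keys_iff\<close>)
  then have "f = (\<lambda>x. \<Sum>m\<in>Poly_Mapping.keys P. Poly_Mapping.lookup P m * (\<Prod>i<n. a i x ^ Poly_Mapping.lookup m i))"
    by (simp add: P(2) mpoly_eval_def)
  then show ?thesis using keys finite_keys by blast
qed

text \<open>
  Products with a coordinate function, which are those in Euler's identity below, amount to raising
  one exponent in every monomial.
\<close>

lemma mpoly_functions_mult_var:
  assumes f: "f \<in> mpoly_functions n a" and j: "j < n"
  shows "(\<lambda>x. c * a j x * f x) \<in> mpoly_functions n a"
proof -
  obtain M d where M: "finite M" "\<And>m. m \<in> M \<Longrightarrow> Poly_Mapping.keys m \<subseteq> {..<n}"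
    and f_eq: "f = (\<lambda>x. \<Sum>m\<in>M. d m * (\<Prod>i<n. a i x ^ Poly_Mapping.lookup m i))"
    using mpoly_functions_expand[OF f] by blast
  define s where "s m = m + Poly_Mapping.single j 1" for m :: "nat \<Rightarrow>\<^sub>0 nat"
  have "(\<Prod>i<n. a i x ^ Poly_Mapping.lookup (s m) i) =
      (\<Prod>i<n. a i x ^ Poly_Mapping.lookup m i) * a j x" for m x
  proof -
    have "(\<Prod>i<n. a i x ^ Poly_Mapping.lookup (s m) i) =
        (\<Prod>i<n. a i x ^ Poly_Mapping.lookup m i * (if i = j then a j x else 1))"
      by (rule prod.cong) (auto simp: s_def lookup_add lookup_single when_def power_add)
    then show ?thesis using j by (simp add: prod.distrib prod.delta)
  qed
  then have "(\<lambda>x. c * a j x * f x) = (\<lambda>x. \<Sum>m\<in>M. (c * d m) * (\<Prod>i<n. a i x ^ Poly_Mapping.lookup (s m) i))"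
    by (simp add: f_eq sum_distrib_left mult_ac)
  moreover have "Poly_Mapping.keys (s m) \<subseteq> {..<n}" if "m \<in> M" for m
    using M(2)[OF that] j Poly_Mapping.keys_add[of m "Poly_Mapping.single j 1"] by (auto simp: s_def)
  ultimately show ?thesis
    by (simp only:) (intro mpoly_functions_sum mpoly_functions_monomial)
qed

lemma mpoly_functions_scale:
  assumes f: "f \<in> mpoly_functions n a"
  shows "(\<lambda>x. c * f x) \<in> mpoly_functions n a"
proof -
  obtain M d where M: "finite M" "\<And>m. m \<in> M \<Longrightarrow> Poly_Mapping.keys m \<subseteq> {..<n}"
    and f_eq: "f = (\<lambda>x. \<Sum>m\<in>M. d m * (\<Prod>i<n. a i x ^ Poly_Mapping.lookup m i))"
    using mpoly_functions_expand[OF f] by blast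
  have "(\<lambda>x. c * f x) = (\<lambda>x. \<Sum>m\<in>M. (c * d m) * (\<Prod>i<n. a i x ^ Poly_Mapping.lookup m i))"
    by (simp add: f_eq sum_distrib_left mult_ac)
  then show ?thesis
    by (simp only:) (intro mpoly_functions_sum mpoly_functions_monomial M(2))
qed

section \<open>Euler's identity\<close>

text \<open>
  For a space \<open>A\<close> of functions that are determined by their values on a finite set \<open>B\<close>, Gaussian
  elimination yields an interpolation formula. The \<open>\<alpha> b\<close> span \<open>A\<close>; points of \<open>B\<close> that add no
  information about a function get \<open>\<alpha> b = 0\<close>.
\<close>

lemma ex_interpolating_family:
  fixes A :: "('a \<Rightarrow> 'k::field) set"
  assumes "finite B" and "(\<lambda>x. 0) \<in> A"
    and "\<And>f g c. f \<in> A \<Longrightarrow> g \<in> A \<Longrightarrow> (\<lambda>x. f x + c * g x) \<in> A"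
    and "\<And>f. f \<in> A \<Longrightarrow> (\<forall>b\<in>B. f b = 0) \<Longrightarrow> f = (\<lambda>x. 0)"
  shows "\<exists>\<alpha>. (\<forall>b\<in>B. \<alpha> b \<in> A) \<and> (\<forall>f\<in>A. \<forall>x. f x = (\<Sum>b\<in>B. f b * \<alpha> b x))"
  using assms
proof (induction B arbitrary: A)
  case empty
  have "f x = 0" if "f \<in> A" for f x using empty.prems(3)[OF that] by simp
  then show ?case by simp
next
  case (insert b B)
  define A0 where "A0 = {f \<in> A. f b = 0}"
  have "\<exists>\<alpha>. (\<forall>c\<in>B. \<alpha> c \<in> A0) \<and> (\<forall>f\<in>A0. \<forall>x. f x = (\<Sum>c\<in>B. f c * \<alpha> c x))"
  proof (rule insert.IH)
    show "(\<lambda>x. 0) \<in> A0" using insert.prems(1) by (simp add: A0_def)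
    show "(\<lambda>x. f x + c * g x) \<in> A0" if "f \<in> A0" "g \<in> A0" for f g c
      using insert.prems(2) that by (simp add: A0_def)
    show "f = (\<lambda>x. 0)" if "f \<in> A0" "\<forall>b\<in>B. f b = 0" for f
      using that by (intro insert.prems(3)) (auto simp: A0_def)
  qed
  then obtain \<alpha> where \<alpha>: "\<And>c. c \<in> B \<Longrightarrow> \<alpha> c \<in> A0"
    and rep: "\<And>f x. f \<in> A0 \<Longrightarrow> f x = (\<Sum>c\<in>B. f c * \<alpha> c x)" by blast
  have upd: "(\<Sum>c\<in>B. k c * (if c = b then \<beta> else \<alpha> c) x) = (\<Sum>c\<in>B. k c * \<alpha> c x)" for k \<beta> x
    using insert.hyps by (intro sum.cong) auto
  show ?case
  proof (cases "A \<subseteq> A0")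
    case True
    then have "f x = (\<Sum>c\<in>insert b B. f c * (\<alpha>(b := (\<lambda>x. 0))) c x)" if "f \<in> A" for f x
      using rep[OF subsetD[OF True that], of x] insert.hyps by (simp add: upd)
    then show ?thesis
      using \<alpha> insert.prems(1) by (intro exI[of _ "\<alpha>(b := (\<lambda>x. 0))"]) (auto simp: A0_def)
  next
    case False
    then obtain f1 where f1: "f1 \<in> A" "f1 b \<noteq> 0" by (auto simp: A0_def)
    define e where "e = (\<lambda>x. 0 + (1 / f1 b) * f1 x)"
    have e: "e \<in> A" "e b = 1"
      unfolding e_def by (rule insert.prems(2)[OF insert.prems(1) f1(1)]) (use f1(2) in simp)
    note lin = insert.prems(2)
    \<comment> \<open>Subtracting from \<open>e\<close> its interpolant on \<open>B\<close> corrects \<open>e\<close> on \<open>B\<close>.\<close>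
    define \<beta> where "\<beta> x = e x - (\<Sum>c\<in>B. e c * \<alpha> c x)" for x
    have "(\<lambda>x. e x - (\<Sum>c\<in>C. e c * \<alpha> c x)) \<in> A" if "C \<subseteq> B" for C
      using finite_subset[OF that insert.hyps(1)] that
    proof (induction C rule: finite_induct)
      case (insert c C)
      then have "(\<lambda>x. (e x - (\<Sum>c\<in>C. e c * \<alpha> c x)) + (- e c) * \<alpha> c x) \<in> A"
        using \<alpha>[of c] by (intro lin) (auto simp: A0_def)
      then show ?case using insert.hyps by (simp add: algebra_simps)
    qed (use e in simp)
    then have "\<beta> \<in> A" unfolding \<beta>_def[abs_def] by blast
    moreover have "f x = (\<Sum>c\<in>insert b B. f c * (\<alpha>(b := \<beta>)) c x)" if f: "f \<in> A" for f x
    proof -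
      have "(\<lambda>x. f x + (- f b) * e x) \<in> A0"
        using insert.prems(2)[OF f e(1), of "- f b"] e(2) by (simp add: A0_def)
      from rep[OF this, of x] have "f x - f b * e x = (\<Sum>c\<in>B. (f c - f b * e c) * \<alpha> c x)"
        by simp
      also have "\<dots> = (\<Sum>c\<in>B. f c * \<alpha> c x) - f b * (\<Sum>c\<in>B. e c * \<alpha> c x)"
        by (simp add: sum_subtractf sum_distrib_left algebra_simps)
      finally have "f x = (\<Sum>c\<in>B. f c * \<alpha> c x) + f b * \<beta> x"
        by (simp add: \<beta>_def algebra_simps)
      then show ?thesis using insert.hyps by (simp add: upd)
    qed
    ultimately show ?thesis
      using \<alpha> by (intro exI[of _ "\<alpha>(b := \<beta>)"]) (auto simp: A0_def)
  qed
qed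

text \<open>
  The functions \<open>\<alpha> b\<close> act as linear coordinates on the group and the points \<open>b\<close> as the corresponding
  directions. Such data exist whenever the continuous additive functions are determined by their
  values on a finite set.
\<close>

locale additive_interpolation =
  fixes B :: "'a::topological_ab_group_add set" and \<alpha> :: "'a \<Rightarrow> 'a \<Rightarrow> complex"
  assumes finite: "finite B"
    and additive: "\<And>b. b \<in> B \<Longrightarrow> Modules.additive (\<alpha> b)"
    and continuous: "\<And>b. b \<in> B \<Longrightarrow> continuous_on UNIV (\<alpha> b)"
    and representation: "\<And>a x. Modules.additive a \<Longrightarrow> continuous_on UNIV a \<Longrightarrow>
      a x = (\<Sum>b\<in>B. a b * \<alpha> b x)"
begin

text \<open>
  Modulo lower degree, the difference in the direction \<open>h\<close> is the combination of the differences in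
  the directions \<open>b\<close> with coefficients \<open>\<alpha> b h\<close>. For \<open>p\<close> of degree at most one this is the
  interpolation formula, since \<open>difference h p x\<close> is then additive in \<open>h\<close>.
\<close>

lemma degree_less_difference_expansion:
  fixes p :: "'a \<Rightarrow> complex"
  shows "continuous_on UNIV p \<Longrightarrow> degree_less_on UNIV (Suc (Suc d)) p \<Longrightarrow>
    degree_less_on UNIV d (\<lambda>x. (\<Sum>b\<in>B. \<alpha> b h * difference b p x) - difference h p x)"
proof (induction d arbitrary: p)
  case 0
  have rep: "difference k p x = (\<Sum>b\<in>B. difference b p x * \<alpha> b k)" for k x
  proof (rule representation)
    have "difference y p (x + k) = difference y p x" for k y
      using 0(2) by (simp add: degree_less_on_Suc degree_less_on_0 difference_def)
    then show "Modules.additive (\<lambda>h. difference h p x)"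
      unfolding Modules.additive_def difference_def by (metis (no_types, lifting) add.assoc add_diff_cancel_left' diff_add_cancel group_cancel.sub1)
    show "continuous_on UNIV (\<lambda>h. difference h p x)"
      unfolding difference_def
      by (intro continuous_intros continuous_on_compose2[OF 0(1)]) auto
  qed
  have "(\<Sum>b\<in>B. \<alpha> b h * difference b p x) = difference h p x" for x
    by (rule trans[OF sum.cong rep[symmetric]]) (simp_all add: mult.commute)
  then show ?case
    by (simp add: degree_less_on_0)
next
  case (Suc d)
  have "difference k (\<lambda>x. (\<Sum>b\<in>B. \<alpha> b h * difference b p x) - difference h p x) =
      (\<lambda>x. (\<Sum>b\<in>B. \<alpha> b h * difference b (difference k p) x) - difference h (difference k p) x)" for k
    by (simp add: difference_def fun_eq_iff right_diff_distrib sum_subtractf ac_simps)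
  moreover have "degree_less_on UNIV (Suc (Suc d)) (difference k p)" for k
    by (rule degree_less_on_difference[OF Suc.prems(2) UNIV_I])
  ultimately show ?case
    using Suc.IH[OF continuous_on_difference[OF Suc.prems(1)]] by (intro degree_less_on_SucI) simp
qed

text \<open>
  The discrete counterpart of the operator \<open>\<Sum> x\<^sub>i \<partial>/\<partial>x\<^sub>i\<close>.
\<close>

definition euler :: "('a \<Rightarrow> complex) \<Rightarrow> 'a \<Rightarrow> complex"
  where "euler p = (\<lambda>x. \<Sum>b\<in>B. \<alpha> b x * difference b p x)"

lemma difference_euler:
  "difference h (\<lambda>x. euler p x - of_nat (Suc d) * p x) =
     (\<lambda>x. (euler (difference h p) x - of_nat d * difference h p x)
       + ((\<Sum>b\<in>B. \<alpha> b h * difference b p x) - difference h p x)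
       + (\<Sum>b\<in>B. \<alpha> b h * difference b (difference h p) x))"
proof
  fix x
  have "euler p (x + h) = (\<Sum>b\<in>B. \<alpha> b x * difference b p x + \<alpha> b x * difference b (difference h p) x
      + \<alpha> b h * difference b p x + \<alpha> b h * difference b (difference h p) x)"
    unfolding euler_def
  proof (rule sum.cong)
    fix b assume "b \<in> B"
    then have "\<alpha> b (x + h) = \<alpha> b x + \<alpha> b h" by (simp add: additive.add additive)
    then show "\<alpha> b (x + h) * difference b p (x + h) =
        \<alpha> b x * difference b p x + \<alpha> b x * difference b (difference h p) x
        + \<alpha> b h * difference b p x + \<alpha> b h * difference b (difference h p) x"
      by (simp add: difference_def algebra_simps)
  qed simp
  also have "\<dots> = euler p x + euler (difference h p) x + (\<Sum>b\<in>B. \<alpha> b h * difference b p x)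
      + (\<Sum>b\<in>B. \<alpha> b h * difference b (difference h p) x)"
    by (simp add: euler_def sum.distrib)
  finally show "difference h (\<lambda>x. euler p x - of_nat (Suc d) * p x) x =
       (euler (difference h p) x - of_nat d * difference h p x)
       + ((\<Sum>b\<in>B. \<alpha> b h * difference b p x) - difference h p x)
       + (\<Sum>b\<in>B. \<alpha> b h * difference b (difference h p) x)"
    by (simp add: difference_def[of h] algebra_simps)
qed

text \<open>
  Euler's identity for homogeneous functions, up to terms of lower degree. The step of the induction
  differentiates it once: by \<open>difference_euler\<close> the result is the identity for \<open>difference h p\<close>,
  the expansion of the difference in the direction \<open>h\<close>, and second differences of \<open>p\<close>.
\<close>

lemma degree_less_euler:
  "continuous_on UNIV p \<Longrightarrow> degree_less_on UNIV (Suc d) p \<Longrightarrow>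
    degree_less_on UNIV d (\<lambda>x. euler p x - of_nat d * p x)"
proof (induction d arbitrary: p)
  case 0
  then show ?case by (simp add: degree_less_on_Suc degree_less_on_0 euler_def)
next
  case (Suc d)
  have diff: "degree_less_on UNIV (Suc d) (difference k p)" for k
    by (rule degree_less_on_difference[OF Suc.prems(2) UNIV_I])
  have "degree_less_on UNIV d (\<lambda>x. \<Sum>b\<in>B. \<alpha> b h * difference b (difference h p) x)" for h
  proof (rule degree_less_on_sum)
    fix b
    have "degree_less_on UNIV d (difference b (difference h p))"
      by (rule degree_less_on_difference[OF diff UNIV_I])
    then show "degree_less_on UNIV d (\<lambda>x. \<alpha> b h * difference b (difference h p) x)"
      by (rule degree_less_on_additive_compose[rotated]) (simp add: Modules.additive_def distrib_left)
  qed
  then have "degree_less_on UNIV d (difference h (\<lambda>x. euler p x - of_nat (Suc d) * p x))" for h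
    unfolding difference_euler
    by (intro degree_less_on_add Suc.IH continuous_on_difference Suc.prems(1) diff
          degree_less_difference_expansion Suc.prems(2))
  then show ?case by (rule degree_less_on_SucI)
qed

lemma continuous_on_euler: "continuous_on UNIV p \<Longrightarrow> continuous_on UNIV (euler p)"
  unfolding euler_def by (intro continuous_intros continuous continuous_on_difference)

text \<open>
  Euler's identity, divided by the degree, expresses \<open>p\<close> through the coordinates \<open>\<alpha> b\<close> and
  functions of lower degree.
\<close>

lemma degree_less_imp_complex_polynomial:
  fixes p :: "'a \<Rightarrow> complex"
  assumes "continuous_on UNIV p" "degree_less_on UNIV n p"
  shows "complex_polynomial p"
proof -
  obtain e where e: "bij_betw e {..<card B} B"
    using ex_bij_betw_nat_finite[OF finite] by (auto simp: atLeast0LessThan)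
  define M where "M = mpoly_functions (card B) (\<lambda>i. \<alpha> (e i))"
  have var: "(\<lambda>x. c * \<alpha> b x * f x) \<in> M" if "b \<in> B" "f \<in> M" for b c f
  proof -
    have "b \<in> e ` {..<card B}" using e that(1) by (simp add: bij_betw_def)
    then obtain i where "i < card B" "b = e i" by auto
    then show ?thesis using mpoly_functions_mult_var[of f "card B" "\<lambda>i. \<alpha> (e i)" i c] that(2)
      by (simp add: M_def)
  qed
  have "p \<in> M"
    using assms
  proof (induction n arbitrary: p)
    case 0
    then have "p = (\<lambda>x. 0)" by (auto simp: degree_less_on_0)
    then show ?case by (simp add: M_def mpoly_functions_const)
  next
    case (Suc d)
    show ?case
    proof (cases "d = 0")
      case True
      then have "p x = p 0" for x
        using degree_less_on_difference[OF Suc.prems(2) UNIV_I, of x]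
        by (simp add: degree_less_on_0 difference_def) (metis add_0)
      then have "p = (\<lambda>x. p 0)" by (simp add: fun_eq_iff)
      then show ?thesis unfolding M_def using mpoly_functions_const by metis
    next
      case False
      define r where "r x = euler p x - of_nat d * p x" for x
      have "r \<in> M"
        unfolding r_def
        by (intro Suc.IH degree_less_euler Suc.prems continuous_intros continuous_on_euler)
      moreover have "(\<lambda>x. \<Sum>b\<in>B. (1 / of_nat d) * \<alpha> b x * difference b p x) \<in> M"
        unfolding M_def
      proof (rule mpoly_functions_sum, fold M_def)
        fix b assume "b \<in> B"
        moreover have "difference b p \<in> M"
          by (intro Suc.IH continuous_on_difference degree_less_on_difference Suc.prems UNIV_I)
        ultimately show "(\<lambda>x. (1 / of_nat d) * \<alpha> b x * difference b p x) \<in> M" by (rule var)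
      qed
      ultimately have "(\<lambda>x. (\<Sum>b\<in>B. (1 / of_nat d) * \<alpha> b x * difference b p x) + (- 1 / of_nat d) * r x) \<in> M"
        unfolding M_def by (intro mpoly_functions_add mpoly_functions_scale)
      also have "(\<lambda>x. (\<Sum>b\<in>B. (1 / of_nat d) * \<alpha> b x * difference b p x) + (- 1 / of_nat d) * r x) = p"
        using False by (simp add: r_def euler_def fun_eq_iff field_simps sum_divide_distrib[symmetric])
      finally show ?thesis .
    qed
  qed
  then obtain P where "mpoly_vars P \<subseteq> {..<card B}" "p = (\<lambda>x. mpoly_eval P (\<lambda>i. \<alpha> (e i) x))"
    unfolding M_def mpoly_functions_def by blast
  moreover have "e i \<in> B" if "i < card B" for i
    using e that by (auto simp: bij_betw_def)
  ultimately show ?thesis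
    unfolding complex_polynomial_def using additive continuous
    by (intro exI[of _ "card B"] exI[of _ "\<lambda>i. \<alpha> (e i)"] exI[of _ P]) auto
qed

end

section \<open>The equivalence for groups with a dense subgroup of finite rank\<close>

text \<open>
  Finite rank enters only through this consequence. The generating set is symmetric and contains
  \<open>0\<close>, so the semigroup that it generates is a group.
\<close>

lemma finite_rank_ex_subgroup:
  assumes H: "add_subgroup H" and rank: "torsion_free_rank H < \<infinity>"
  obtains X where "finite X" "0 \<in> X" "\<And>x. x \<in> X \<Longrightarrow> - x \<in> X" "X \<subseteq> H"
    "\<And>h. h \<in> H \<Longrightarrow> \<exists>m>0. nat_mult m h \<in> subsemigroup_gen X"
proof -
  define B where "B = (SOME B. maximal_indep_system H B)"
  have B: "maximal_indep_system H B"
    unfolding B_def by (rule someI_ex[OF ex_maximal_indep_system])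
  have "finite B"
    using rank unfolding torsion_free_rank_def B_def[symmetric] Let_def by (auto split: if_splits)
  have BH: "B \<subseteq> H" using B by (auto simp: maximal_indep_system_def indep_system_def)
  define X where "X = insert 0 (B \<union> uminus ` B)"
  have X: "finite X" "0 \<in> X" "X \<subseteq> H" "\<And>x. x \<in> X \<Longrightarrow> - x \<in> X"
    using \<open>finite B\<close> BH H by (auto simp: X_def add_subgroup_def)
  moreover have "B \<subseteq> subsemigroup_gen X"
    by (auto simp: X_def intro: subsemigroup_gen.base)
  ultimately show ?thesis
    using torsion_over_maximal_indep_system[OF B _ add_subgroup_subsemigroup_gen[OF X(2,4)]]
    by (intro that[of X]) auto
qed

lemma degree_less_imp_local_polynomial:
  assumes f: "continuous_on UNIV f" "degree_less_on UNIV n f"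
  shows "local_polynomial f"
proof -
  have "polynomial_on (subsemigroup_gen X) f" if "finite X" for X
  proof -
    let ?S = "subsemigroup_gen X"
    have d: "degree_less_on ?S n f" by (rule degree_less_on_subset[OF f(2)]) simp
    have "\<exists>D. finite D \<and> (\<forall>s\<in>?S. (\<lambda>x. if x \<in> ?S then f (x + s) else 0) \<in> cfun.span D)"
      by (rule translates_in_finite_span[OF that _ _ d]) (auto intro: subsemigroup_gen.intros)
    then obtain D where "finite D" "translates_on ?S f \<subseteq> cfun.span D"
      unfolding translates_on_def by blast
    then have "finite_dim_subspace (cfun.span (translates_on ?S f))"
      by (rule finite_dim_subspace_span)
    moreover have "generalized_polynomial_on ?S f"
      using d continuous_on_subset[OF f(1)]
      by (subst generalized_polynomial_on_iff) (auto intro: subsemigroup_gen.add)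
    ultimately show ?thesis by (simp add: polynomial_on_def)
  qed
  then show ?thesis using f(1) by (simp add: local_polynomial_def)
qed

context
  fixes H X :: "'a::topological_ab_group_add set"
  assumes H: "add_subgroup H" "closure H = UNIV"
    and X: "finite X" "0 \<in> X" "\<And>x. x \<in> X \<Longrightarrow> - x \<in> X" "X \<subseteq> H"
    and tor: "\<And>h. h \<in> H \<Longrightarrow> \<exists>m>0. nat_mult m h \<in> subsemigroup_gen X"
begin

private lemma F: "add_subgroup (subsemigroup_gen X)" "subsemigroup_gen X \<subseteq> H"
  using add_subgroup_subsemigroup_gen[OF X(2,3)] subsemigroup_gen_minimal[OF _ X(4)] H(1)
  by (auto simp: add_subgroup_def)

text \<open>
  The degree of \<open>f\<close> on a finitely generated semigroup may depend on that semigroup. The degree \<open>n\<close>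
  on the subgroup generated by \<open>X\<close> bounds all of them on \<open>H\<close>: any finitely many elements of \<open>H\<close>
  lie in a finitely generated group \<open>K\<close> that is a torsion extension of this subgroup.
\<close>

lemma local_polynomial_imp_degree_less:
  fixes f :: "'a \<Rightarrow> 'e::complex_banach"
  assumes "local_polynomial f"
  shows "\<exists>n. degree_less_on UNIV n f"
proof -
  have local: "\<exists>n. degree_less_on (subsemigroup_gen Y) n f" if "finite Y" "Y \<noteq> {}" for Y
  proof -
    have "generalized_polynomial_on (subsemigroup_gen Y) f"
      using assms that by (auto simp: local_polynomial_def polynomial_on_def)
    then show ?thesis
      by (subst (asm) generalized_polynomial_on_iff) (auto intro: subsemigroup_gen.add)
  qed
  obtain n where n: "degree_less_on (subsemigroup_gen X) n f"
    using local[OF X(1)] X(2) by auto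
  have "degree_less_on H n f"
    unfolding degree_less_on_def
  proof (intro allI impI ballI, elim conjE)
    fix hs x assume hs: "length hs = n" "set hs \<subseteq> H" and x: "x \<in> H"
    define Y where "Y = X \<union> insert x (set hs) \<union> uminus ` insert x (set hs)"
    let ?K = "subsemigroup_gen Y"
    have "Y \<subseteq> H" using X hs x H(1) by (auto simp: Y_def add_subgroup_def)
    then have KH: "?K \<subseteq> H" using H(1) by (intro subsemigroup_gen_minimal) (auto simp: add_subgroup_def)
    have FK: "subsemigroup_gen X \<subseteq> ?K" by (rule subsemigroup_gen_mono) (auto simp: Y_def)
    have K: "add_subgroup ?K" by (rule add_subgroup_subsemigroup_gen) (use X in \<open>auto simp: Y_def\<close>)
    obtain N where N: "degree_less_on ?K N f"
      using local[of Y] X(1) by (auto simp: Y_def)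
    have "degree_less_on ?K n f"
      by (rule degree_less_on_torsion_extension[OF K F(1) FK _ N n]) (use tor KH in blast)
    then show "foldr difference hs f x = 0"
      by (rule degree_less_onD) (use hs in \<open>auto simp: Y_def intro: subsemigroup_gen.base\<close>)
  qed
  then have "degree_less_on UNIV n f"
    using assms by (intro degree_less_on_dense[OF H(2)]) (simp_all add: local_polynomial_def)
  then show ?thesis ..
qed

lemma degree_less_imp_polynomial:
  fixes f :: "'a \<Rightarrow> 'e::complex_banach"
  assumes f: "continuous_on UNIV f" "degree_less_on UNIV n f"
  shows "polynomial f"
proof -
  obtain D where D: "finite D" "\<And>s. s \<in> subsemigroup_gen X \<Longrightarrow> (\<lambda>x. f (x + s)) \<in> cfun.span D"
    using translates_in_finite_span[OF X(1) subset_UNIV _ f(2)] by auto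
  have "translates_on UNIV f \<subseteq> cfun.span D"
    using translates_in_span_from_dense_torsion[OF H F tor f D] by (auto simp: translates_on_def)
  then have "finite_dim_subspace (cfun.span (translates_on UNIV f))"
    by (rule finite_dim_subspace_span[OF D(1)])
  then show ?thesis
    using f generalized_polynomial_on_iff[of UNIV f] by (auto simp: polynomial_on_def)
qed

lemma continuous_additive_eq_0:
  fixes a :: "'a \<Rightarrow> complex"
  assumes "Modules.additive a" "continuous_on UNIV a" "\<And>x. x \<in> X \<Longrightarrow> a x = 0"
  shows "a = (\<lambda>x. 0)"
proof -
  have "a x = 0" if "x \<in> subsemigroup_gen X" for x
    using that by induction (simp_all add: assms(3) additive.add[OF assms(1)])
  then have "degree_less_on (subsemigroup_gen X) 0 a" by (simp add: degree_less_on_0)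
  moreover have "degree_less_on H 2 a"
    by (rule degree_less_on_subset[OF degree_less_additive[OF assms(1)]]) simp
  ultimately have "degree_less_on H 0 a"
    using degree_less_on_torsion_extension[OF H(1) F tor] by blast
  then show ?thesis
    using zero_on_dense[OF assms(2) H(2)] by (simp add: degree_less_on_0 fun_eq_iff)
qed

lemma ex_additive_interpolation: "\<exists>\<alpha>. additive_interpolation X \<alpha>"
proof -
  define A :: "('a \<Rightarrow> complex) set" where "A = {a. Modules.additive a \<and> continuous_on UNIV a}"
  have "\<exists>\<alpha>. (\<forall>b\<in>X. \<alpha> b \<in> A) \<and> (\<forall>f\<in>A. \<forall>x. f x = (\<Sum>b\<in>X. f b * \<alpha> b x))"
  proof (rule ex_interpolating_family[OF X(1)])
    show "(\<lambda>x. 0) \<in> A" by (simp add: A_def Modules.additive_def)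
    show "(\<lambda>x. f x + c * g x) \<in> A" if "f \<in> A" "g \<in> A" for f g c
      using that by (auto simp: A_def Modules.additive_def algebra_simps intro!: continuous_intros)
    show "f = (\<lambda>x. 0)" if "f \<in> A" "\<forall>b\<in>X. f b = 0" for f
      using that by (intro continuous_additive_eq_0) (auto simp: A_def)
  qed
  then show ?thesis
    using X(1) unfolding additive_interpolation_def A_def by blast
qed

text \<open>
  Continuous additive functions are determined by their values on \<open>X\<close>, so Euler's identity is
  available on the whole group.
\<close>

lemma degree_less_imp_w_polynomial:
  fixes f :: "'a \<Rightarrow> 'e::complex_banach"
  assumes f: "continuous_on UNIV f" "degree_less_on UNIV n f"
  shows "w_polynomial f"
  unfolding w_polynomial_def
proof (intro conjI ballI f(1))
  fix u :: "'e \<Rightarrow> complex" assume u: "u \<in> dual_space"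
  obtain \<alpha> :: "'a \<Rightarrow> 'a \<Rightarrow> complex" where "additive_interpolation X \<alpha>" using ex_additive_interpolation by blast
  then interpret additive_interpolation X \<alpha> .
  have "continuous_on UNIV (u \<circ> f)"
    using u f(1) by (intro continuous_on_compose) (auto simp: dual_space_def intro: continuous_on_subset)
  moreover have "degree_less_on UNIV n (\<lambda>x. u (f x))"
    by (rule degree_less_on_additive_compose[OF _ f(2)])
      (use u in \<open>simp add: dual_space_def Vector_Spaces.linear_iff Modules.additive_def\<close>)
  ultimately show "complex_polynomial (u \<circ> f)"
    by (intro degree_less_imp_complex_polynomial) (simp_all add: comp_def)
qed

end

theorem theorem9:
  fixes f :: "'a::topological_ab_group_add \<Rightarrow> 'e::complex_banach" and H :: "'a set"
  assumes "add_subgroup H" and "closure H = UNIV" and "torsion_free_rank H < \<infinity>"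
    and "continuous_on UNIV f"
  shows "(polynomial f \<longleftrightarrow> w_polynomial f) \<and>
    (w_polynomial f \<longleftrightarrow> generalized_polynomial f) \<and>
    (generalized_polynomial f \<longleftrightarrow> local_polynomial f)"
proof -
  obtain X where X: "finite X" "0 \<in> X" "\<And>x. x \<in> X \<Longrightarrow> - x \<in> X" "X \<subseteq> H"
    "\<And>h. h \<in> H \<Longrightarrow> \<exists>m>0. nat_mult m h \<in> subsemigroup_gen X"
    using finite_rank_ex_subgroup[OF assms(1,3)] by blast
  note rank = assms(1,2) X
  have gp: "generalized_polynomial f \<longleftrightarrow> (\<exists>n. degree_less_on UNIV n f)"
    using assms(4) by (subst generalized_polynomial_on_iff) auto
  moreover have "polynomial f \<longleftrightarrow> generalized_polynomial f"
    using degree_less_imp_polynomial[OF rank assms(4)] gp by (auto simp: polynomial_on_def)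
  moreover have "w_polynomial f \<longleftrightarrow> (\<exists>n. degree_less_on UNIV n f)"
    using degree_less_imp_w_polynomial[OF rank assms(4)] w_polynomial_imp_degree_less by blast
  moreover have "local_polynomial f \<longleftrightarrow> (\<exists>n. degree_less_on UNIV n f)"
    using degree_less_imp_local_polynomial[OF assms(4)] local_polynomial_imp_degree_less[OF rank] by blast
  ultimately show ?thesis by simp
qed

end
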